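(* Let $a,b,c,d$ be real numbers with $a^2+b^2>0$, let $A(\gamma)=a\gamma^3+b\gamma^2+c\gamma+d$, and let $\varphi:\mathbb{R}\to\mathbb{S}^2\subset\mathbb{R}^3$ be the proper biharmonic map $$\varphi(\gamma)=\left(\cos(A(\gamma)),\ \sin(A(\gamma)),\ 0\right).$$ Assume that either $a=0$, or $a\ne0$ and $b^2-3ac\le0$. Then $\varphi$ is strictly stable (with respect to compactly supported variations).
   Context: $\mathbb{R}$ carries the standard metric and $\mathbb{S}^2$ is the unit sphere. For a smooth map $\varphi:M\to N$ of Riemannian manifolds, the tension field is $\tau(\varphi)=\mathrm{trace}\,\nabla d\varphi$. For a compact set $D\subset M$ with smooth boundary put $E_2(\varphi;D)=\frac12\int_D|\tau(\varphi)|^2\,dv_M$. When $M$ is non-compact, $\varphi$ is biharmonic if it is critical for $E_2(\,\cdot\,;D)$ with respect to variations equal to $\varphi$ outside $D$, for all such $D$; it is proper if $\tau(\varphi)\not\equiv0$. For a biharmonic map $\varphi$ and a smooth two-parameter variation $\varphi_{t,s}$ with $\varphi_{0,0}=\varphi$ and $\varphi_{t,s}=\varphi$ outside $D$, let $V=\frac{d}{dt}|_{t=0}\varphi_{t,0}$ and $W=\frac{d}{ds}|_{s=0}\varphi_{0,s}$ (smooth sections of $\varphi^{-1}TN$ vanishing outside $D$), and let $$H(E_2)_{(\varphi;D)}(V,W)=\frac{\partial^2}{\partial t\,\partial s}\Big|_{(t,s)=(0,0)}E_2(\varphi_{t,s};D)=\int_M\langle I_2(V),W\rangle\,dv_M .$$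 When $N=\mathbb{S}^n$ is the unit sphere, with $\{e_i\}$ a local orthonormal frame of $M$, $\nabla^\varphi$ the induced connection on $\varphi^{-1}TN$ and $\overline{\Delta}=-\sum_i(\nabla^\varphi_{e_i}\nabla^\varphi_{e_i}-\nabla^\varphi_{\nabla^M_{e_i}e_i})$, one has $$\begin{aligned}I_2(V)=\ &\overline{\Delta}^2V+\overline{\Delta}\big(T(V)-|d\varphi|^2V\big)+2\langle d\tau(\varphi),d\varphi\rangle V+|\tau(\varphi)|^2V-2\sum_i\langle V,\nabla^\varphi_{e_i}\tau(\varphi)\rangle d\varphi(e_i)\\&-2\sum_i\langle\tau(\varphi),\nabla^\varphi_{e_i}V\rangle d\varphi(e_i)-\langle\tau(\varphi),V\rangle\tau(\varphi)+T(\overline{\Delta}V)+T(T(V))-2|d\varphi|^2T(V)\\&+2\langle dV,d\varphi\rangle\tau(\varphi)-|d\varphi|^2\overline{\Delta}V+|d\varphi|^4V,\end{aligned}$$ where $T(V)=\sum_i\langle V,d\varphi(e_i)\rangle d\varphi(e_i)$, $\langle d\tau(\varphi),d\varphi\rangle=\sum_i\langle\nabla^\varphi_{e_i}\tau(\varphi),d\varphi(e_i)\rangle$ and $\langle dV,d\varphi\rangle=\sum_i\langle\nabla^\varphi_{e_i}V,d\varphi(e_i)\rangle$. The biharmonic map $\varphi$ is strictly stable if $H(E_2)_{(\varphi;D)}(V,V)>0$ for all nontrivial compactly supported smooth sections $V$ of $\varphi^{-1}TN$ (where $D$ contains the support of $V$). *)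

theory Defs
  imports "HOL-Analysis.Analysis"
begin

text \<open>
  \<open>C\<^sup>k\<close> and smooth maps on an open subset \<open>S\<close> of a Euclidean space, through
  iterated directional derivatives.
\<close>

primrec Ck_on :: "nat \<Rightarrow> ('a::euclidean_space \<Rightarrow> 'b::euclidean_space) \<Rightarrow> 'a set \<Rightarrow> bool" where
  "Ck_on 0 f S \<longleftrightarrow> continuous_on S f"
| "Ck_on (Suc k) f S \<longleftrightarrow>
     (\<forall>x\<in>S. f differentiable (at x)) \<and>
     (\<forall>v. Ck_on k (\<lambda>x. frechet_derivative f (at x) v) S)"

definition smooth_on :: "('a::euclidean_space \<Rightarrow> 'b::euclidean_space) \<Rightarrow> 'a set \<Rightarrow> bool" where
  "smooth_on f S \<longleftrightarrow> (\<forall>k. Ck_on k f S)"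

text \<open>
  Everything below concerns maps from the real line, with its standard metric, to the unit
  sphere \<open>sphere 0 1\<close> of a Euclidean space with the induced metric. A map into the sphere, and
  a section of the pulled-back tangent bundle, are represented by functions with values in
  the ambient space.
\<close>

definition smooth_sphere_map :: "(real \<Rightarrow> 'a::euclidean_space) \<Rightarrow> bool" where
  "smooth_sphere_map \<phi> \<longleftrightarrow> smooth_on \<phi> UNIV \<and> (\<forall>x. \<phi> x \<in> sphere 0 1)"

definition smooth_section :: "(real \<Rightarrow> 'a::euclidean_space) \<Rightarrow> (real \<Rightarrow> 'a) \<Rightarrow> bool" where
  "smooth_section \<phi> V \<longleftrightarrow> smooth_on V UNIV \<and> (\<forall>x. V x \<bullet> \<phi> x = 0)"

definition section_support :: "(real \<Rightarrow> 'a::euclidean_space) \<Rightarrow> real set" where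
  "section_support V = closure {x. V x \<noteq> 0}"

text \<open>
  The Levi-Civita connection of the sphere is the ambient derivative followed by the orthogonal
  projection to the tangent space; \<open>cov_deriv \<phi> V x\<close> is the induced connection on the
  pulled-back bundle applied to \<open>V\<close>, in the direction of the unit field \<open>e = d/dx\<close> of the line.
\<close>

definition tangent_proj :: "'a::euclidean_space \<Rightarrow> 'a \<Rightarrow> 'a" where
  "tangent_proj p v = v - (v \<bullet> p) *\<^sub>R p"

definition cov_deriv :: "(real \<Rightarrow> 'a::euclidean_space) \<Rightarrow> (real \<Rightarrow> 'a) \<Rightarrow> real \<Rightarrow> 'a" where
  "cov_deriv \<phi> V x = tangent_proj (\<phi> x) (vector_derivative V (at x))"

text \<open>
  The trace of \<open>\<nabla>d\<phi>\<close> over the one-element orthonormal frame \<open>e\<close>; the term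
  \<open>d\<phi>(\<nabla>\<^sub>e e)\<close> vanishes on the line.
\<close>

definition tension :: "(real \<Rightarrow> 'a::euclidean_space) \<Rightarrow> real \<Rightarrow> 'a" where
  "tension \<phi> = cov_deriv \<phi> (\<lambda>x. vector_derivative \<phi> (at x))"

text \<open>
  The compact subsets of the line with smooth boundary are the finite disjoint unions of
  nondegenerate compact intervals.
\<close>

definition compact_smooth_domain :: "real set \<Rightarrow> bool" where
  "compact_smooth_domain D \<longleftrightarrow>
     (\<exists>\<I>. finite \<I> \<and> disjoint \<I> \<and> (\<forall>I\<in>\<I>. \<exists>a b. a < b \<and> I = {a..b}) \<and> D = \<Union>\<I>)"

definition bienergy :: "(real \<Rightarrow> 'a::euclidean_space) \<Rightarrow> real set \<Rightarrow> real" where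
  "bienergy \<phi> D = (1/2) * integral D (\<lambda>x. (norm (tension \<phi> x))\<^sup>2)"

definition variation1 ::
    "(real \<Rightarrow> 'a::euclidean_space) \<Rightarrow> real set \<Rightarrow> (real \<Rightarrow> real \<Rightarrow> 'a) \<Rightarrow> bool" where
  "variation1 \<phi> D \<Phi> \<longleftrightarrow>
     (\<exists>\<epsilon>>0. smooth_on (\<lambda>(t, x). \<Phi> t x) ({-\<epsilon><..<\<epsilon>} \<times> UNIV) \<and>
        (\<forall>t\<in>{-\<epsilon><..<\<epsilon>}. (\<forall>x. \<Phi> t x \<in> sphere 0 1) \<and> (\<forall>x. x \<notin> D \<longrightarrow> \<Phi> t x = \<phi> x)) \<and>
        \<Phi> 0 = \<phi>)"

definition biharmonic :: "(real \<Rightarrow> 'a::euclidean_space) \<Rightarrow> bool" where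
  "biharmonic \<phi> \<longleftrightarrow> smooth_sphere_map \<phi> \<and>
     (\<forall>D \<Phi>. compact_smooth_domain D \<and> variation1 \<phi> D \<Phi> \<longrightarrow>
        ((\<lambda>t. bienergy (\<Phi> t) D) has_real_derivative 0) (at 0))"

definition proper_biharmonic :: "(real \<Rightarrow> 'a::euclidean_space) \<Rightarrow> bool" where
  "proper_biharmonic \<phi> \<longleftrightarrow> biharmonic \<phi> \<and> (\<exists>x. tension \<phi> x \<noteq> 0)"

definition variation2 ::
    "(real \<Rightarrow> 'a::euclidean_space) \<Rightarrow> real set \<Rightarrow> (real \<Rightarrow> real \<Rightarrow> real \<Rightarrow> 'a) \<Rightarrow> bool" where
  "variation2 \<phi> D \<Phi> \<longleftrightarrow>
     (\<exists>\<epsilon>>0. smooth_on (\<lambda>(t, s, x). \<Phi> t s x) ({-\<epsilon><..<\<epsilon>} \<times> {-\<epsilon><..<\<epsilon>} \<times> UNIV) \<and>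
        (\<forall>t\<in>{-\<epsilon><..<\<epsilon>}. \<forall>s\<in>{-\<epsilon><..<\<epsilon>}.
           (\<forall>x. \<Phi> t s x \<in> sphere 0 1) \<and> (\<forall>x. x \<notin> D \<longrightarrow> \<Phi> t s x = \<phi> x)) \<and>
        \<Phi> 0 0 = \<phi>)"

definition variation_fields ::
    "(real \<Rightarrow> real \<Rightarrow> real \<Rightarrow> 'a::euclidean_space) \<Rightarrow> (real \<Rightarrow> 'a) \<Rightarrow> (real \<Rightarrow> 'a) \<Rightarrow> bool" where
  "variation_fields \<Phi> V W \<longleftrightarrow>
     (\<forall>x. ((\<lambda>t. \<Phi> t 0 x) has_vector_derivative V x) (at 0) \<and>
          ((\<lambda>s. \<Phi> 0 s x) has_vector_derivative W x) (at 0))"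

definition has_mixed_derivative_0 :: "(real \<Rightarrow> real \<Rightarrow> real) \<Rightarrow> real \<Rightarrow> bool" where
  "has_mixed_derivative_0 F h \<longleftrightarrow>
     (\<exists>G. (\<forall>\<^sub>F t in nhds 0. ((\<lambda>s. F t s) has_real_derivative G t) (at 0)) \<and>
          (G has_real_derivative h) (at 0))"

text \<open>
  The second variation of the bienergy at a biharmonic map: the mixed derivative at the origin,
  which there does not depend on the variation inducing \<open>V\<close> and \<open>W\<close>. The description \<open>THE\<close>
  denotes a determined number only if some variation induces \<open>V\<close> and \<open>W\<close> and all of them
  give the same value, so a statement about it is not satisfied vacuously.
\<close>

definition bienergy_hessian ::
    "(real \<Rightarrow> 'a::euclidean_space) \<Rightarrow> real set \<Rightarrow> (real \<Rightarrow> 'a) \<Rightarrow> (real \<Rightarrow> 'a) \<Rightarrow> real" where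
  "bienergy_hessian \<phi> D V W =
     (THE h. \<forall>\<Phi>. variation2 \<phi> D \<Phi> \<and> variation_fields \<Phi> V W \<longrightarrow>
        has_mixed_derivative_0 (\<lambda>t s. bienergy (\<Phi> t s) D) h)"

definition strictly_stable :: "(real \<Rightarrow> 'a::euclidean_space) \<Rightarrow> bool" where
  "strictly_stable \<phi> \<longleftrightarrow> biharmonic \<phi> \<and>
     (\<forall>V D. smooth_section \<phi> V \<and> compact (section_support V) \<and> (\<exists>x. V x \<noteq> 0) \<and>
        compact_smooth_domain D \<and> section_support V \<subseteq> D \<longrightarrow>
        bienergy_hessian \<phi> D V V > 0)"

end

theory Submission
  imports Defs
begin

text \<open>
  Everything is computed in the ambient Euclidean space. For a curve \<open>\<gamma>\<close> of unit vectors,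
  \<open>\<gamma>'' \<bullet> \<gamma> = - \<bar>\<gamma>'\<bar>\<^sup>2\<close>, so the tension field has \<open>\<bar>\<tau>\<bar>\<^sup>2 = \<bar>\<gamma>''\<bar>\<^sup>2 - \<bar>\<gamma>'\<bar>^4\<close> and the bienergy is a
  constrained variational integral with Euler-Lagrange equation
  \<open>\<phi>'''' + 2 (\<bar>\<phi>'\<bar>\<^sup>2 \<phi>')' = \<mu> \<phi>\<close>, where \<open>\<mu>\<close> is the Lagrange multiplier of the sphere. Every solution
  is biharmonic, because a variation field is orthogonal to \<open>\<phi>\<close> (\<open>sphere_curve_ode.biharmonic\<close>).

  The mixed derivative of the bienergy of a two-parameter variation \<open>\<Phi>\<close> contains, besides terms
  in the variation fields \<open>V\<close> and \<open>W\<close>, a term linear in \<open>Z = \<partial>\<^sub>t \<partial>\<^sub>s \<Phi>\<close>. Integrating that term by parts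
  with the equation leaves \<open>\<integral> \<mu> (\<phi> \<bullet> Z)\<close>, and two derivatives of \<open>\<bar>\<Phi>\<bar>\<^sup>2 = 1\<close> give \<open>\<phi> \<bullet> Z = - V \<bullet> W\<close>.
  Therefore the second variation depends only on the fields:
  \<open>\<integral> V'' \<bullet> W'' - 2 \<bar>\<phi>'\<bar>\<^sup>2 (V' \<bullet> W') - 4 (\<phi>' \<bullet> V') (\<phi>' \<bullet> W') - \<mu> (V \<bullet> W)\<close>
  (\<open>has_mixed_derivative_bienergy\<close>). Together with an explicit variation inducing given fields this
  evaluates the Hessian (\<open>bienergy_hessian_eq\<close>).

  For the cubic curve, put \<open>\<alpha> = A'\<close> and let \<open>e1 = (- sin A, cos A, 0)\<close>, \<open>e2 = (0, 0, 1)\<close> be the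
  parallel frame along \<open>\<phi>\<close>. The equation holds because \<open>\<alpha>''' = 0\<close>. With \<open>V = f e1 + g e2\<close> the
  integrand of the Hessian equals, up to the derivative of a compactly supported function,
  \<open>f''\<^sup>2 + (g'' + \<alpha>\<^sup>2 g)\<^sup>2 + (\<alpha>'\<^sup>2 + 2 \<alpha> \<alpha>'') g\<^sup>2\<close> (\<open>hessian_sum_of_squares\<close>), and
  \<open>\<alpha>'\<^sup>2 + 2 \<alpha> \<alpha>'' = 8 (3 a x + b)\<^sup>2 - 4 (b\<^sup>2 - 3 a c)\<close>. Under the hypotheses this potential is nonnegative
  and vanishes at no more than one point. So a vanishing Hessian forces \<open>f'' = 0\<close>, hence \<open>f = 0\<close> by
  compact support, and \<open>g = 0\<close> off one point, hence everywhere.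
\<close>

section \<open>Directional derivatives and the calculus of smooth maps\<close>

definition dir_deriv :: "'a::euclidean_space \<Rightarrow> ('a \<Rightarrow> 'b::euclidean_space) \<Rightarrow> 'a \<Rightarrow> 'b" where
  "dir_deriv v f x = frechet_derivative f (at x) v"

lemma dir_deriv_eq: "(f has_derivative f') (at x) \<Longrightarrow> dir_deriv v f x = f' v"
  unfolding dir_deriv_def using frechet_derivative_at by metis

lemma Ck_on_Suc_dir_deriv:
  "Ck_on (Suc k) f S \<longleftrightarrow> (\<forall>x\<in>S. f differentiable (at x)) \<and> (\<forall>v. Ck_on k (dir_deriv v f) S)"
  unfolding dir_deriv_def by simp

declare Ck_on.simps(2) [simp del]

lemma dir_deriv_cong_open:
  assumes "open S" "\<And>x. x \<in> S \<Longrightarrow> f x = g x" "x \<in> S" "f differentiable (at x)"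
  shows "g differentiable (at x)" "dir_deriv v g x = dir_deriv v f x"
proof -
  have "(f has_derivative frechet_derivative f (at x)) (at x)"
    using assms(4) frechet_derivative_works by blast
  then have *: "(g has_derivative frechet_derivative f (at x)) (at x)"
    by (rule has_derivative_transform_within_open) (use assms in auto)
  then show "g differentiable (at x)" by (rule differentiableI)
  show "dir_deriv v g x = dir_deriv v f x"
    using dir_deriv_eq[OF *] by (simp add: dir_deriv_def)
qed

lemma Ck_on_cong:
  assumes "open S" "\<And>x. x \<in> S \<Longrightarrow> f x = g x" "Ck_on k f S"
  shows "Ck_on k g S"
  using assms(2,3)
proof (induction k arbitrary: f g)
  case 0
  then show ?case by (simp cong: continuous_on_cong)
next
  case (Suc k)
  have diff: "f differentiable (at x)" if "x \<in> S" for x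
    using Suc.prems(2) that by (auto simp: Ck_on_Suc_dir_deriv)
  have "Ck_on k (dir_deriv v g) S" for v
  proof (rule Suc.IH)
    show "Ck_on k (dir_deriv v f) S" using Suc.prems(2) by (auto simp: Ck_on_Suc_dir_deriv)
    show "dir_deriv v f x = dir_deriv v g x" if "x \<in> S" for x
      using dir_deriv_cong_open(2)[OF assms(1) Suc.prems(1) that diff[OF that]] by simp
  qed
  moreover have "g differentiable (at x)" if "x \<in> S" for x
    using dir_deriv_cong_open(1)[OF assms(1) Suc.prems(1) that diff[OF that]] by simp
  ultimately show ?case
    unfolding Ck_on_Suc_dir_deriv by blast
qed

lemma Ck_on_Suc_imp: "Ck_on (Suc k) f S \<Longrightarrow> Ck_on k f S"
proof (induction k arbitrary: f)
  case 0
  then show ?case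
    by (auto simp: Ck_on_Suc_dir_deriv intro!: continuous_at_imp_continuous_on differentiable_imp_continuous_within)
next
  case (Suc k)
  then show ?case by (metis Ck_on_Suc_dir_deriv)
qed

text \<open>
  The closure properties below go by induction on \<open>k\<close>: this rule reduces \<open>C\<^sup>k\<^sup>+\<^sup>1\<close> to \<open>C\<^sup>k\<close> of an
  explicit formula for the derivative, which has to agree with the chosen Frechet derivative on
  \<open>S\<close> only.
\<close>

lemma Ck_on_SucI:
  assumes "open S" and "\<And>x. x \<in> S \<Longrightarrow> (f has_derivative f' x) (at x)"
    and "\<And>v. Ck_on k (\<lambda>x. f' x v) S"
  shows "Ck_on (Suc k) f S"
  unfolding Ck_on_Suc_dir_deriv
proof (intro conjI ballI allI)
  show "f differentiable (at x)" if "x \<in> S" for x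
    using assms(2)[OF that] by (rule differentiableI)
  show "Ck_on k (dir_deriv v f) S" for v
    by (rule Ck_on_cong[OF assms(1) _ assms(3)[of v]]) (simp add: dir_deriv_eq[OF assms(2)])
qed

lemma Ck_on_Suc_has_derivative:
  "Ck_on (Suc k) f S \<Longrightarrow> x \<in> S \<Longrightarrow> (f has_derivative (\<lambda>v. dir_deriv v f x)) (at x)"
  unfolding dir_deriv_def by (auto simp: Ck_on_Suc_dir_deriv frechet_derivative_works[symmetric])

lemma Ck_on_Suc_dir_derivD: "Ck_on (Suc k) f S \<Longrightarrow> Ck_on k (dir_deriv v f) S"
  by (simp add: Ck_on_Suc_dir_deriv)

lemma Ck_on_const:
  assumes "open S" shows "Ck_on k (\<lambda>x. c) S"
proof (induction k arbitrary: c)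
  case (Suc k)
  then show ?case by (intro Ck_on_SucI[where f' = "\<lambda>_ _. 0"] assms) auto
qed simp

lemma Ck_on_linear:
  assumes "open S" "bounded_linear f" shows "Ck_on k f S"
proof (cases k)
  case 0
  then show ?thesis using assms by (simp add: linear_continuous_on)
next
  case (Suc k)
  then show ?thesis
    using assms by (auto intro!: Ck_on_SucI[where f' = "\<lambda>_. f"] Ck_on_const bounded_linear_imp_has_derivative)
qed

lemma Ck_on_add:
  assumes "open S" "Ck_on k f S" "Ck_on k g S"
  shows "Ck_on k (\<lambda>x. f x + g x) S"
  using assms(2,3)
proof (induction k arbitrary: f g)
  case 0
  then show ?case by (simp add: continuous_on_add)
next
  case (Suc k)
  then show ?case
    by (intro Ck_on_SucI[where f' = "\<lambda>x v. dir_deriv v f x + dir_deriv v g x"] assms(1))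
      (auto intro!: derivative_intros Ck_on_Suc_has_derivative intro: Ck_on_Suc_dir_derivD)
qed

lemma Ck_on_bilinear:
  fixes h :: "'b::euclidean_space \<Rightarrow> 'c::euclidean_space \<Rightarrow> 'd::euclidean_space"
    and f :: "'a::euclidean_space \<Rightarrow> 'b"
  assumes "bounded_bilinear h" "open S" "Ck_on k f S" "Ck_on k g S"
  shows "Ck_on k (\<lambda>x. h (f x) (g x)) S"
  using assms(3,4)
proof (induction k arbitrary: f g)
  case 0
  then show ?case using bounded_bilinear.continuous_on[OF assms(1), of S f g] by simp
next
  case (Suc k)
  show ?case
  proof (rule Ck_on_SucI[OF assms(2)])
    show "((\<lambda>x. h (f x) (g x)) has_derivative
        (\<lambda>v. h (f x) (dir_deriv v g x) + h (dir_deriv v f x) (g x))) (at x)" if "x \<in> S" for x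
      using Suc.prems that by (intro bounded_bilinear.FDERIV[OF assms(1)] Ck_on_Suc_has_derivative)
    show "Ck_on k (\<lambda>x. h (f x) (dir_deriv v g x) + h (dir_deriv v f x) (g x)) S" for v
      using Suc.prems by (intro Ck_on_add assms(2) Suc.IH Ck_on_Suc_dir_derivD Ck_on_Suc_imp[of k])
  qed
qed

lemma Ck_on_linear_compose:
  fixes f :: "'b::euclidean_space \<Rightarrow> 'c::euclidean_space" and L :: "'a::euclidean_space \<Rightarrow> 'b"
  assumes "open S" "bounded_linear L" "L ` S \<subseteq> T" "Ck_on k f T"
  shows "Ck_on k (\<lambda>x. f (L x)) S"
  using assms(4)
proof (induction k arbitrary: f)
  case 0
  then show ?case
    using continuous_on_compose2[OF _ linear_continuous_on[OF assms(2)] assms(3)] by simp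
next
  case (Suc k)
  show ?case
  proof (rule Ck_on_SucI[OF assms(1), where f' = "\<lambda>x v. dir_deriv (L v) f (L x)"])
    show "((\<lambda>x. f (L x)) has_derivative (\<lambda>v. dir_deriv (L v) f (L x))) (at x)" if "x \<in> S" for x
    proof (rule has_derivative_compose[where f = L and g = f])
      show "(L has_derivative L) (at x)"
        using assms(2) by (rule bounded_linear_imp_has_derivative)
      show "(f has_derivative (\<lambda>v. dir_deriv v f (L x))) (at (L x))"
        using Suc.prems assms(3) that by (intro Ck_on_Suc_has_derivative) auto
    qed
    show "Ck_on k (\<lambda>x. dir_deriv (L v) f (L x)) S" for v
      using Suc.prems by (intro Suc.IH Ck_on_Suc_dir_derivD)
  qed
qed

text \<open>
  The derivative of \<open>1/f\<close> is \<open>- (1/f) f' (1/f)\<close>, which again contains \<open>1/f\<close>, now to be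
  differentiated one time fewer. So the induction needs only products.
\<close>

lemma Ck_on_inverse:
  fixes f :: "'a::euclidean_space \<Rightarrow> real"
  assumes "open S" "\<And>x. x \<in> S \<Longrightarrow> f x \<noteq> 0" "Ck_on k f S"
  shows "Ck_on k (\<lambda>x. inverse (f x)) S"
  using assms(3)
proof (induction k)
  case 0
  then show ?case using assms(2) by (auto intro: continuous_on_inverse)
next
  case (Suc k)
  have inv: "Ck_on k (\<lambda>x. inverse (f x)) S"
    using Suc Ck_on_Suc_imp by blast
  show ?case
  proof (rule Ck_on_SucI[OF assms(1)])
    show "((\<lambda>x. inverse (f x)) has_derivative
        (\<lambda>v. - (inverse (f x) * dir_deriv v f x * inverse (f x)))) (at x)" if "x \<in> S" for x
      using Ck_on_Suc_has_derivative[OF Suc.prems that] assms(2)[OF that]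
      by (intro Deriv.has_derivative_inverse) auto
    have "Ck_on k (\<lambda>x. (-1) * (inverse (f x) * dir_deriv v f x * inverse (f x))) S" for v
      by (intro Ck_on_bilinear[OF bounded_bilinear_mult] Ck_on_const assms(1) inv
          Ck_on_Suc_dir_derivD[OF Suc.prems])
    then show "Ck_on k (\<lambda>x. - (inverse (f x) * dir_deriv v f x * inverse (f x))) S" for v
      by simp
  qed
qed

lemma smooth_on_const: "open S \<Longrightarrow> smooth_on (\<lambda>x. c) S"
  unfolding smooth_on_def using Ck_on_const by auto

lemma smooth_on_linear: "open S \<Longrightarrow> bounded_linear f \<Longrightarrow> smooth_on f S"
  unfolding smooth_on_def using Ck_on_linear by auto

lemma smooth_on_add: "open S \<Longrightarrow> smooth_on f S \<Longrightarrow> smooth_on g S \<Longrightarrow> smooth_on (\<lambda>x. f x + g x) S"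
  unfolding smooth_on_def using Ck_on_add[of S _ f g] by simp

lemma smooth_on_linear_compose:
  "open S \<Longrightarrow> bounded_linear L \<Longrightarrow> L ` S \<subseteq> T \<Longrightarrow> smooth_on f T \<Longrightarrow> smooth_on (\<lambda>x. f (L x)) S"
  unfolding smooth_on_def using Ck_on_linear_compose[of S L T _ f] by simp

lemma smooth_on_bilinear:
  "bounded_bilinear h \<Longrightarrow> open S \<Longrightarrow> smooth_on f S \<Longrightarrow> smooth_on g S \<Longrightarrow> smooth_on (\<lambda>x. h (f x) (g x)) S"
  unfolding smooth_on_def using Ck_on_bilinear[of h S _ f g] by simp

lemma smooth_on_inverse:
  fixes f :: "'a::euclidean_space \<Rightarrow> real"
  shows "open S \<Longrightarrow> (\<And>x. x \<in> S \<Longrightarrow> f x \<noteq> 0) \<Longrightarrow> smooth_on f S \<Longrightarrow> smooth_on (\<lambda>x. inverse (f x)) S"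
  unfolding smooth_on_def using Ck_on_inverse[of S f] by simp

lemma smooth_on_dir_deriv: "smooth_on f S \<Longrightarrow> smooth_on (dir_deriv v f) S"
  unfolding smooth_on_def using Ck_on_Suc_dir_derivD[of _ f S v] by simp

lemma smooth_on_continuous_on: "smooth_on f S \<Longrightarrow> continuous_on S f"
  unfolding smooth_on_def by (metis Ck_on.simps(1))

lemma smooth_on_has_derivative:
  "smooth_on f S \<Longrightarrow> x \<in> S \<Longrightarrow> (f has_derivative (\<lambda>v. dir_deriv v f x)) (at x)"
  unfolding smooth_on_def by (metis Ck_on_Suc_has_derivative)

lemma dir_deriv_cong:
  assumes "open S" "smooth_on f S" "\<And>x. x \<in> S \<Longrightarrow> g x = f x" "x \<in> S"
  shows "dir_deriv v g x = dir_deriv v f x"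
  using dir_deriv_cong_open(2)[of S f g x v] assms
    differentiableI[OF smooth_on_has_derivative[OF assms(2,4)]] by simp

lemma smooth_on_inner:
  "open S \<Longrightarrow> smooth_on f S \<Longrightarrow> smooth_on g S \<Longrightarrow> smooth_on (\<lambda>x. f x \<bullet> g x) S"
  by (rule smooth_on_bilinear[OF bounded_bilinear_inner])

lemma smooth_on_mult:
  fixes f g :: "'a::euclidean_space \<Rightarrow> real"
  shows "open S \<Longrightarrow> smooth_on f S \<Longrightarrow> smooth_on g S \<Longrightarrow> smooth_on (\<lambda>x. f x * g x) S"
  by (rule smooth_on_bilinear[OF bounded_bilinear_mult])

lemma smooth_on_scaleR:
  "open S \<Longrightarrow> smooth_on f S \<Longrightarrow> smooth_on g S \<Longrightarrow> smooth_on (\<lambda>x. f x *\<^sub>R g x) S"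
  by (rule smooth_on_bilinear[OF bounded_bilinear_scaleR])

lemma smooth_on_diff:
  assumes "open S" "smooth_on f S" "smooth_on g S"
  shows "smooth_on (\<lambda>x. f x - g x) S"
  using smooth_on_add[OF assms(1,2) smooth_on_scaleR[OF assms(1) smooth_on_const[OF assms(1), of "-1"] assms(3)]]
  by simp

lemmas smooth_on_intros = smooth_on_const smooth_on_add smooth_on_diff smooth_on_inner smooth_on_mult
  smooth_on_scaleR smooth_on_dir_deriv

section \<open>Derivatives along lines, parameter integrals and symmetry\<close>

lemma smooth_on_line:
  assumes "smooth_on f S" "p + r *\<^sub>R w \<in> S"
  shows "((\<lambda>r. f (p + r *\<^sub>R w)) has_vector_derivative dir_deriv w f (p + r *\<^sub>R w)) (at r)"
proof -
  note D = smooth_on_has_derivative[OF assms]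
  have "((\<lambda>r. f (p + r *\<^sub>R w)) has_derivative (\<lambda>h. dir_deriv (h *\<^sub>R w) f (p + r *\<^sub>R w))) (at r)"
    by (rule has_derivative_compose[where f = "\<lambda>r. p + r *\<^sub>R w" and g = f, OF _ D])
      (auto intro!: derivative_eq_intros)
  moreover have "dir_deriv (h *\<^sub>R w) f (p + r *\<^sub>R w) = h *\<^sub>R dir_deriv w f (p + r *\<^sub>R w)" for h
    using has_derivative_linear[OF D] by (rule linear_scale)
  ultimately show ?thesis by (simp add: has_vector_derivative_def)
qed

text \<open>
  Here \<open>w\<close> is the direction of the parameter and \<open>e\<close> that of integration. Working with
  lines in an arbitrary Euclidean space covers families with one parameter and families with two
  parameters alike.
\<close>

lemma leibniz_rule_line:
  fixes f g :: "'a::euclidean_space \<Rightarrow> 'b::euclidean_space"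
  assumes f: "continuous_on S f" and g: "continuous_on S g"
    and deriv: "\<And>q. q \<in> S \<Longrightarrow> ((\<lambda>r. f (q + r *\<^sub>R w)) has_vector_derivative g q) (at 0)"
    and S: "\<And>r x. \<bar>r\<bar> < \<delta> \<Longrightarrow> x \<in> {a..b} \<Longrightarrow> p + r *\<^sub>R w + x *\<^sub>R e \<in> S" and "\<bar>r0\<bar> < \<delta>"
  shows "((\<lambda>r. integral {a..b} (\<lambda>x. f (p + r *\<^sub>R w + x *\<^sub>R e))) has_vector_derivative
          integral {a..b} (\<lambda>x. g (p + r0 *\<^sub>R w + x *\<^sub>R e))) (at r0)"
proof -
  let ?U = "{-\<delta><..<\<delta>}"
  have "((\<lambda>r. integral (cbox a b) (\<lambda>x. f (p + r *\<^sub>R w + x *\<^sub>R e))) has_vector_derivative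
          integral (cbox a b) (\<lambda>x. g (p + r0 *\<^sub>R w + x *\<^sub>R e))) (at r0 within ?U)"
  proof (rule leibniz_rule_vector_derivative)
    show "((\<lambda>r. f (p + r *\<^sub>R w + x *\<^sub>R e)) has_vector_derivative g (p + r *\<^sub>R w + x *\<^sub>R e)) (at r within ?U)"
      if "r \<in> ?U" "x \<in> cbox a b" for r x
    proof (rule has_vector_derivative_at_within)
      let ?q = "p + r *\<^sub>R w + x *\<^sub>R e"
      have "((\<lambda>u. f (?q + u *\<^sub>R w)) has_vector_derivative g ?q) (at 0)"
        using S[of r x] that by (intro deriv) auto
      moreover have "((\<lambda>u. u - r) has_vector_derivative 1) (at r)"
        by (auto intro!: derivative_eq_intros)
      ultimately have "(((\<lambda>u. f (?q + u *\<^sub>R w)) \<circ> (\<lambda>u. u - r)) has_vector_derivative 1 *\<^sub>R g ?q) (at r)"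
        by (intro vector_diff_chain_at) auto
      then show "((\<lambda>r. f (p + r *\<^sub>R w + x *\<^sub>R e)) has_vector_derivative g ?q) (at r)"
        by (simp add: o_def algebra_simps)
    qed
    show "(\<lambda>x. f (p + r *\<^sub>R w + x *\<^sub>R e)) integrable_on cbox a b" if "r \<in> ?U" for r
      using S[of r] that
      by (intro integrable_continuous continuous_on_compose2[OF f] continuous_intros) auto
    show "continuous_on (?U \<times> cbox a b) (\<lambda>(r, x). g (p + r *\<^sub>R w + x *\<^sub>R e))"
      using S unfolding case_prod_beta
      by (intro continuous_on_compose2[OF g] continuous_intros) auto
  qed (use assms(5) in auto)
  moreover have "r0 \<in> ?U" using assms(5) by auto
  ultimately show ?thesis by (simp add: at_within_open[of r0 ?U])
qed

text \<open>
  Symmetry of second derivatives without difference quotients: the fundamental theorem writes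
  \<open>f (p + r v + s w) - f (p + r v)\<close> as an integral of the derivative in direction \<open>w\<close>.
  Differentiating under the integral in \<open>r\<close> and then in the upper limit \<open>s\<close> yields the two orders.
\<close>

lemma dir_deriv_commute:
  fixes f :: "'a::euclidean_space \<Rightarrow> 'b::euclidean_space"
  assumes "open S" "smooth_on f S" "p \<in> S"
  shows "dir_deriv v (dir_deriv w f) p = dir_deriv w (dir_deriv v f) p"
proof -
  obtain \<epsilon> where \<epsilon>: "\<epsilon> > 0" "ball p \<epsilon> \<subseteq> S"
    using assms(1,3) open_contains_ball by blast
  define m where "m = norm v + norm w + 1"
  have m: "m > 0" "norm v + norm w < m" by (auto simp: m_def add_nonneg_pos)
  define \<delta> where "\<delta> = \<epsilon> / m"
  have "\<delta> > 0" using \<epsilon> m by (simp add: \<delta>_def)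
  have S: "p + r *\<^sub>R v + s *\<^sub>R w \<in> S" if "\<bar>r\<bar> < \<delta>" "\<bar>s\<bar> < \<delta>" for r s
  proof -
    have "norm (r *\<^sub>R v + s *\<^sub>R w) \<le> \<bar>r\<bar> * norm v + \<bar>s\<bar> * norm w"
      using norm_triangle_ineq[of "r *\<^sub>R v" "s *\<^sub>R w"] by simp
    also have "\<dots> \<le> \<delta> * norm v + \<delta> * norm w"
      using that by (intro add_mono mult_right_mono) auto
    also have "\<dots> < \<delta> * m"
      using mult_strict_left_mono[OF m(2) \<open>\<delta> > 0\<close>] by (simp add: distrib_left)
    also have "\<dots> = \<epsilon>" using m by (simp add: \<delta>_def)
    finally have "dist p (p + r *\<^sub>R v + s *\<^sub>R w) < \<epsilon>"
      by (metis add.assoc add_diff_cancel_left' dist_commute dist_norm)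
    then show ?thesis using \<epsilon>(2) by auto
  qed
  have key: "dir_deriv v f (p + s *\<^sub>R w) - dir_deriv v f p
      = integral {0..s} (\<lambda>y. dir_deriv v (dir_deriv w f) (p + y *\<^sub>R w))"
    if s: "0 \<le> s" "s < \<delta>" for s
  proof -
    have I: "((\<lambda>r. integral {0..s} (\<lambda>y. dir_deriv w f (p + r *\<^sub>R v + y *\<^sub>R w))) has_vector_derivative
       integral {0..s} (\<lambda>y. dir_deriv v (dir_deriv w f) (p + 0 *\<^sub>R v + y *\<^sub>R w))) (at 0)"
    proof (rule leibniz_rule_line[where S = S and \<delta> = \<delta>])
      show "continuous_on S (dir_deriv w f)" "continuous_on S (dir_deriv v (dir_deriv w f))"
        by (intro smooth_on_continuous_on smooth_on_dir_deriv assms(2))+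
      show "((\<lambda>r. dir_deriv w f (q + r *\<^sub>R v)) has_vector_derivative dir_deriv v (dir_deriv w f) q) (at 0)"
        if "q \<in> S" for q
        using smooth_on_line[OF smooth_on_dir_deriv[OF assms(2)], of q 0 v w] that by simp
      show "p + r *\<^sub>R v + x *\<^sub>R w \<in> S" if "\<bar>r\<bar> < \<delta>" "x \<in> {0..s}" for r x
        using S[of r x] that s by simp
    qed (use \<open>\<delta> > 0\<close> in simp)
    have F: "integral {0..s} (\<lambda>y. dir_deriv w f (p + r *\<^sub>R v + y *\<^sub>R w))
        = f (p + s *\<^sub>R w + r *\<^sub>R v) - f (p + r *\<^sub>R v)" if r: "\<bar>r\<bar> < \<delta>" for r
    proof -
      have "((\<lambda>y. dir_deriv w f (p + r *\<^sub>R v + y *\<^sub>R w)) has_integral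
          (f (p + r *\<^sub>R v + s *\<^sub>R w) - f (p + r *\<^sub>R v + 0 *\<^sub>R w))) {0..s}"
      proof (rule fundamental_theorem_of_calculus[where f = "\<lambda>y. f (p + r *\<^sub>R v + y *\<^sub>R w)"])
        show "((\<lambda>y. f (p + r *\<^sub>R v + y *\<^sub>R w)) has_vector_derivative
            dir_deriv w f (p + r *\<^sub>R v + y *\<^sub>R w)) (at y within {0..s})" if "y \<in> {0..s}" for y
          using S[OF r, of y] that s
          by (intro has_vector_derivative_at_within[OF smooth_on_line[OF assms(2)]]) auto
      qed (use s in simp)
      then show ?thesis by (simp add: integral_unique algebra_simps)
    qed
    have L: "((\<lambda>r. f (p + s *\<^sub>R w + r *\<^sub>R v) - f (p + r *\<^sub>R v)) has_vector_derivative
       integral {0..s} (\<lambda>y. dir_deriv v (dir_deriv w f) (p + 0 *\<^sub>R v + y *\<^sub>R w))) (at 0)"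
      by (rule has_vector_derivative_transform_within_open[OF I, where S = "{-\<delta><..<\<delta>}"])
        (use \<open>\<delta> > 0\<close> F in auto)
    have "((\<lambda>r. f (p + s *\<^sub>R w + r *\<^sub>R v) - f (p + r *\<^sub>R v)) has_vector_derivative
       dir_deriv v f (p + s *\<^sub>R w + 0 *\<^sub>R v) - dir_deriv v f (p + 0 *\<^sub>R v)) (at 0)"
      using S[of 0 s] S[of 0 0] s
      by (intro has_vector_derivative_diff smooth_on_line[OF assms(2)]) auto
    from vector_derivative_unique_at[OF this L] show ?thesis by simp
  qed
  \<comment> \<open>The integral formula is stated for \<open>s \<ge> 0\<close>, so the comparison is of one-sided derivatives at \<open>0\<close>.\<close>
  define \<sigma> where "\<sigma> = \<delta> / 2"
  have \<sigma>: "0 < \<sigma>" "\<sigma> < \<delta>" using \<open>\<delta> > 0\<close> by (auto simp: \<sigma>_def)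
  have "continuous_on {0..\<sigma>} (\<lambda>y. dir_deriv v (dir_deriv w f) (p + y *\<^sub>R w))"
  proof (rule continuous_on_compose2[where f = "\<lambda>y. p + y *\<^sub>R w"])
    show "continuous_on S (dir_deriv v (dir_deriv w f))"
      by (intro smooth_on_continuous_on smooth_on_dir_deriv assms(2))
    show "continuous_on {0..\<sigma>} (\<lambda>y. p + y *\<^sub>R w)" by (intro continuous_intros)
    show "(\<lambda>y. p + y *\<^sub>R w) ` {0..\<sigma>} \<subseteq> S" using S[of 0] \<sigma> \<open>\<delta> > 0\<close> by auto
  qed
  from integral_has_vector_derivative[OF this, of 0] \<sigma>
  have 1: "((\<lambda>s. integral {0..s} (\<lambda>y. dir_deriv v (dir_deriv w f) (p + y *\<^sub>R w)))
      has_vector_derivative dir_deriv v (dir_deriv w f) p) (at 0 within {0..\<sigma>})"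
    by simp
  have "((\<lambda>s. dir_deriv v f (p + s *\<^sub>R w) - dir_deriv v f p)
      has_vector_derivative dir_deriv w (dir_deriv v f) (p + 0 *\<^sub>R w) - 0) (at 0 within {0..\<sigma>})"
    using assms(3) by (intro has_vector_derivative_diff has_vector_derivative_const
        has_vector_derivative_at_within[OF smooth_on_line[OF smooth_on_dir_deriv[OF assms(2)]]]) auto
  then have D: "((\<lambda>s. dir_deriv v f (p + s *\<^sub>R w) - dir_deriv v f p)
      has_vector_derivative dir_deriv w (dir_deriv v f) p) (at 0 within {0..\<sigma>})"
    by simp
  have 2: "((\<lambda>s. integral {0..s} (\<lambda>y. dir_deriv v (dir_deriv w f) (p + y *\<^sub>R w)))
      has_vector_derivative dir_deriv w (dir_deriv v f) p) (at 0 within {0..\<sigma>})"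
    by (rule has_vector_derivative_transform[OF _ _ D]) (use \<sigma> key in auto)
  show ?thesis
    using vector_derivative_unique_within[OF _ 1 2] \<sigma> by (simp add: trivial_limit_within islimpt_Icc)
qed

lemma leibniz_rule_smooth:
  fixes f :: "'a::euclidean_space \<Rightarrow> 'b::euclidean_space"
  assumes f: "smooth_on f S"
    and S: "\<And>r x. \<bar>r\<bar> < \<delta> \<Longrightarrow> x \<in> {a..b} \<Longrightarrow> p + r *\<^sub>R w + x *\<^sub>R e \<in> S" and "\<bar>r0\<bar> < \<delta>"
  shows "((\<lambda>r. integral {a..b} (\<lambda>x. f (p + r *\<^sub>R w + x *\<^sub>R e))) has_vector_derivative
          integral {a..b} (\<lambda>x. dir_deriv w f (p + r0 *\<^sub>R w + x *\<^sub>R e))) (at r0)"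
proof (rule leibniz_rule_line[where S = S and \<delta> = \<delta>])
  show "((\<lambda>r. f (q + r *\<^sub>R w)) has_vector_derivative dir_deriv w f q) (at 0)" if "q \<in> S" for q
    using smooth_on_line[OF f, of q 0 w] that by simp
qed (use assms in \<open>auto intro: smooth_on_continuous_on smooth_on_dir_deriv\<close>)

lemma dir_deriv_line_eq:
  assumes "smooth_on f S" "\<And>x. p + x *\<^sub>R e \<in> S" "\<And>x. f (p + x *\<^sub>R e) = g x"
    and "(g has_vector_derivative g') (at x)"
  shows "dir_deriv e f (p + x *\<^sub>R e) = g'"
proof -
  have "(g has_vector_derivative dir_deriv e f (p + x *\<^sub>R e)) (at x)"
    using smooth_on_line[OF assms(1,2)] assms(3) by simp
  then show ?thesis using assms(4) vector_derivative_unique_at by blast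
qed

lemma dir_deriv_inner_const:
  assumes "open S" "smooth_on f S" "smooth_on g S" "\<And>q. q \<in> S \<Longrightarrow> f q \<bullet> g q = c" "q \<in> S"
  shows "f q \<bullet> dir_deriv v g q + dir_deriv v f q \<bullet> g q = 0"
proof -
  have D: "((\<lambda>x. f x \<bullet> g x) has_derivative (\<lambda>h. f q \<bullet> dir_deriv h g q + dir_deriv h f q \<bullet> g q)) (at q)"
    by (rule has_derivative_inner[OF smooth_on_has_derivative[OF assms(2,5)] smooth_on_has_derivative[OF assms(3,5)]])
  have "((\<lambda>x. c) has_derivative (\<lambda>h. f q \<bullet> dir_deriv h g q + dir_deriv h f q \<bullet> g q)) (at q)"
    by (rule has_derivative_transform_within_open[OF D assms(1,5)]) (use assms(4) in auto)
  from has_derivative_unique[OF this has_derivative_const] show ?thesis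
    by (simp add: fun_eq_iff)
qed

lemma dir_deriv_commute_second:
  assumes "open S" "smooth_on f S" "q \<in> S"
  shows "dir_deriv w (dir_deriv e (dir_deriv e f)) q = dir_deriv e (dir_deriv e (dir_deriv w f)) q"
proof -
  have "dir_deriv w (dir_deriv e (dir_deriv e f)) q = dir_deriv e (dir_deriv w (dir_deriv e f)) q"
    by (intro dir_deriv_commute[OF assms(1) _ assms(3)] smooth_on_dir_deriv assms(2))
  also have "\<dots> = dir_deriv e (dir_deriv e (dir_deriv w f)) q"
    by (rule dir_deriv_cong[OF assms(1) _ _ assms(3)])
      (auto intro: smooth_on_dir_deriv assms(2) dir_deriv_commute[OF assms(1,2)])
  finally show ?thesis .
qed

section \<open>First and second variation integrands\<close>

text \<open>
  For \<open>\<Psi>\<close> with values in the unit sphere this is \<open>\<bar>\<tau>\<bar>\<^sup>2\<close> of the curves \<open>x \<mapsto> \<Psi> (p + x e)\<close>, see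
  \<open>norm_tension_line\<close>. Unlike the tension field it has no projection, so it is a polynomial in the
  derivatives of \<open>\<Psi>\<close>.
\<close>

definition bienergy_density :: "'e::euclidean_space \<Rightarrow> ('e \<Rightarrow> 'a::euclidean_space) \<Rightarrow> 'e \<Rightarrow> real" where
  "bienergy_density e \<Psi> q =
     dir_deriv e (dir_deriv e \<Psi>) q \<bullet> dir_deriv e (dir_deriv e \<Psi>) q
     - (dir_deriv e \<Psi> q \<bullet> dir_deriv e \<Psi> q) * (dir_deriv e \<Psi> q \<bullet> dir_deriv e \<Psi> q)"

text \<open>
  Half the linearisation of the previous density at \<open>\<Psi>\<close> in the direction of the field \<open>Y\<close>.
\<close>

definition first_variation_density ::
  "'e::euclidean_space \<Rightarrow> ('e \<Rightarrow> 'a::euclidean_space) \<Rightarrow> ('e \<Rightarrow> 'a) \<Rightarrow> 'e \<Rightarrow> real" where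
  "first_variation_density e \<Psi> Y q =
     dir_deriv e (dir_deriv e \<Psi>) q \<bullet> dir_deriv e (dir_deriv e Y) q
     - 2 * ((dir_deriv e \<Psi> q \<bullet> dir_deriv e \<Psi> q) * (dir_deriv e \<Psi> q \<bullet> dir_deriv e Y q))"

text \<open>
  The part of the second derivative that involves only first-order variation fields \<open>X\<close> and \<open>Y\<close>. The
  remaining part is the linearisation in the direction of the mixed derivative of \<open>\<Psi>\<close>.
\<close>

definition second_variation_density ::
  "'e::euclidean_space \<Rightarrow> ('e \<Rightarrow> 'a::euclidean_space) \<Rightarrow> ('e \<Rightarrow> 'a) \<Rightarrow> ('e \<Rightarrow> 'a) \<Rightarrow> 'e \<Rightarrow> real" where
  "second_variation_density e \<Psi> X Y q =
     dir_deriv e (dir_deriv e X) q \<bullet> dir_deriv e (dir_deriv e Y) q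
     - 2 * ((dir_deriv e \<Psi> q \<bullet> dir_deriv e \<Psi> q) * (dir_deriv e X q \<bullet> dir_deriv e Y q))
     - 4 * ((dir_deriv e \<Psi> q \<bullet> dir_deriv e X q) * (dir_deriv e \<Psi> q \<bullet> dir_deriv e Y q))"

lemma smooth_on_densities:
  assumes "open S" "smooth_on \<Psi> S"
  shows "smooth_on (bienergy_density e \<Psi>) S"
    and "smooth_on Y S \<Longrightarrow> smooth_on (first_variation_density e \<Psi> Y) S"
proof -
  show "smooth_on (bienergy_density e \<Psi>) S"
    unfolding bienergy_density_def[abs_def] by (intro smooth_on_intros assms)
  show "smooth_on (first_variation_density e \<Psi> Y) S" if "smooth_on Y S"
    unfolding first_variation_density_def[abs_def] by (intro smooth_on_intros assms that)
qed

lemma dir_deriv_bienergy_density: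
  assumes S: "open S" and \<Psi>: "smooth_on \<Psi> S" and q: "q \<in> S"
  shows "dir_deriv w (bienergy_density e \<Psi>) q = 2 * first_variation_density e \<Psi> (dir_deriv w \<Psi>) q"
proof -
  let ?x = "dir_deriv e \<Psi>" let ?xx = "dir_deriv e ?x"
  have "((\<lambda>q. ?xx q \<bullet> ?xx q - (?x q \<bullet> ?x q) * (?x q \<bullet> ?x q)) has_derivative
      (\<lambda>h. 2 * (?xx q \<bullet> dir_deriv h ?xx q) - 4 * ((?x q \<bullet> ?x q) * (?x q \<bullet> dir_deriv h ?x q)))) (at q)"
    by (rule has_derivative_eq_rhs, (rule has_derivative_diff has_derivative_inner has_derivative_mult
        smooth_on_has_derivative[OF smooth_on_dir_deriv[OF smooth_on_dir_deriv[OF \<Psi>]] q]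
        smooth_on_has_derivative[OF smooth_on_dir_deriv[OF \<Psi>] q])+) (simp add: fun_eq_iff algebra_simps inner_commute)
  from dir_deriv_eq[OF this, of w] show ?thesis
    unfolding bienergy_density_def[abs_def] first_variation_density_def
    by (simp add: dir_deriv_commute_second[OF S \<Psi> q] dir_deriv_commute[OF S \<Psi> q])
qed

lemma dir_deriv_first_variation_density:
  assumes S: "open S" and \<Psi>: "smooth_on \<Psi> S" and Y: "smooth_on Y S" and q: "q \<in> S"
  shows "dir_deriv v (first_variation_density e \<Psi> Y) q =
    second_variation_density e \<Psi> (dir_deriv v \<Psi>) Y q + first_variation_density e \<Psi> (dir_deriv v Y) q"
proof -
  let ?x = "dir_deriv e \<Psi>" let ?xx = "dir_deriv e ?x"
  let ?y = "dir_deriv e Y" let ?yy = "dir_deriv e ?y"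
  have "((\<lambda>q. ?xx q \<bullet> ?yy q - 2 * ((?x q \<bullet> ?x q) * (?x q \<bullet> ?y q))) has_derivative
      (\<lambda>h. dir_deriv h ?xx q \<bullet> ?yy q + ?xx q \<bullet> dir_deriv h ?yy q
         - 2 * ((?x q \<bullet> ?x q) * (dir_deriv h ?x q \<bullet> ?y q + ?x q \<bullet> dir_deriv h ?y q))
         - 4 * ((?x q \<bullet> dir_deriv h ?x q) * (?x q \<bullet> ?y q)))) (at q)"
    by (rule has_derivative_eq_rhs, (rule has_derivative_diff has_derivative_inner has_derivative_mult
        has_derivative_mult_right
        smooth_on_has_derivative[OF smooth_on_dir_deriv[OF smooth_on_dir_deriv[OF \<Psi>]] q]
        smooth_on_has_derivative[OF smooth_on_dir_deriv[OF \<Psi>] q]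
        smooth_on_has_derivative[OF smooth_on_dir_deriv[OF smooth_on_dir_deriv[OF Y]] q]
        smooth_on_has_derivative[OF smooth_on_dir_deriv[OF Y] q])+) (simp add: fun_eq_iff algebra_simps inner_commute)
  from dir_deriv_eq[OF this, of v] show ?thesis
    unfolding first_variation_density_def[abs_def] second_variation_density_def
    by (simp add: dir_deriv_commute_second[OF S \<Psi> q] dir_deriv_commute[OF S \<Psi> q]
        dir_deriv_commute_second[OF S Y q] dir_deriv_commute[OF S Y q] algebra_simps)
qed

text \<open>
  Differentiating \<open>\<Psi> \<bullet> \<Psi> = 1\<close> twice in direction \<open>e\<close> identifies the normal component of the
  second derivative as \<open>- \<bar>\<partial>\<^sub>e \<Psi>\<bar>\<^sup>2\<close>, and projecting subtracts its square from the squared norm.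
\<close>

lemma norm_tension_line:
  assumes S: "open S" and \<Psi>: "smooth_on \<Psi> S" and unit: "\<And>q. q \<in> S \<Longrightarrow> norm (\<Psi> q) = 1"
    and line: "\<And>x. p + x *\<^sub>R e \<in> S"
  shows "(norm (tension (\<lambda>x. \<Psi> (p + x *\<^sub>R e)) x))\<^sup>2 = bienergy_density e \<Psi> (p + x *\<^sub>R e)"
proof -
  let ?x = "dir_deriv e \<Psi>" let ?q = "p + x *\<^sub>R e"
  note \<Psi>x = smooth_on_dir_deriv[OF \<Psi>]
  have n: "\<Psi> q \<bullet> \<Psi> q = 1" if "q \<in> S" for q
    using unit[OF that] by (simp add: norm_eq_sqrt_inner)
  have "\<Psi> q \<bullet> ?x q = 0" if "q \<in> S" for q
    using dir_deriv_inner_const[OF S \<Psi> \<Psi> n that, of e] by (simp add: inner_commute)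
  from dir_deriv_inner_const[OF S \<Psi> \<Psi>x this line, of x e]
  have o: "dir_deriv e ?x ?q \<bullet> \<Psi> ?q = - (?x ?q \<bullet> ?x ?q)"
    by (simp add: inner_commute)
  have 1: "vector_derivative (\<lambda>x. \<Psi> (p + x *\<^sub>R e)) (at y) = ?x (p + y *\<^sub>R e)" for y
    by (rule vector_derivative_at[OF smooth_on_line[OF \<Psi> line]])
  have 2: "vector_derivative (\<lambda>x. ?x (p + x *\<^sub>R e)) (at y) = dir_deriv e ?x (p + y *\<^sub>R e)" for y
    by (rule vector_derivative_at[OF smooth_on_line[OF \<Psi>x line]])
  have "tension (\<lambda>x. \<Psi> (p + x *\<^sub>R e)) x = dir_deriv e ?x ?q + (?x ?q \<bullet> ?x ?q) *\<^sub>R \<Psi> ?q"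
    unfolding tension_def cov_deriv_def tangent_proj_def 1 2 o by simp
  then show ?thesis
    unfolding power2_norm_eq_inner bienergy_density_def
    by (simp add: inner_add_left inner_add_right n[OF line] o inner_commute[of "\<Psi> ?q"])
qed

lemma tension_cong_open:
  assumes "open U" "\<And>x. x \<in> U \<Longrightarrow> f x = g x" "x \<in> U"
  shows "tension f x = tension g x"
proof -
  have ev: "\<forall>\<^sub>F y in nhds z. y \<in> U" if "z \<in> U" for z
    using assms(1) that by (rule eventually_nhds_in_open)
  have 1: "vector_derivative f (at z) = vector_derivative g (at z)" if "z \<in> U" for z
    by (rule vector_derivative_cong_eq) (use ev[OF that] in \<open>auto elim!: eventually_mono simp: assms(2)\<close>)
  have "vector_derivative (\<lambda>x. vector_derivative f (at x)) (at x) =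
      vector_derivative (\<lambda>x. vector_derivative g (at x)) (at x)"
    by (rule vector_derivative_cong_eq) (use ev[OF assms(3)] in \<open>auto elim!: eventually_mono simp: 1\<close>)
  then show ?thesis
    unfolding tension_def cov_deriv_def using assms(2,3) by simp
qed

text \<open>
  Replaces the domain \<open>D\<close>, on which the competing curves are merely known to agree outside, by
  an interval, where integration by parts has just two boundary points. It works because the tension
  is local and the complement of \<open>D\<close> is open.
\<close>

lemma bienergy_diff_interval:
  assumes D: "compact D" "D \<subseteq> {a..b}" and eq: "\<And>x. x \<notin> D \<Longrightarrow> f x = g x"
    and cont: "continuous_on {a..b} (\<lambda>x. (norm (tension f x))\<^sup>2)"
      "continuous_on {a..b} (\<lambda>x. (norm (tension g x))\<^sup>2)"
  shows "bienergy f D - bienergy g D =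
    (1/2) * (integral {a..b} (\<lambda>x. (norm (tension f x))\<^sup>2) - integral {a..b} (\<lambda>x. (norm (tension g x))\<^sup>2))"
proof -
  let ?f = "\<lambda>x. (norm (tension f x))\<^sup>2" and ?g = "\<lambda>x. (norm (tension g x))\<^sup>2"
  have int: "h integrable_on D" if "continuous_on {a..b} h" for h :: "real \<Rightarrow> real"
  proof -
    have "h absolutely_integrable_on D"
      by (rule set_integrable_subset[OF absolutely_integrable_continuous_real[OF that]])
        (use D compact_imp_closed lmeasurable_compact fmeasurableD in auto)
    then show ?thesis by (rule set_lebesgue_integral_eq_integral)
  qed
  have out: "?f x - ?g x = 0" if "x \<notin> D" for x
    using tension_cong_open[of "- D" f g x] that eq compact_imp_closed[OF D(1)]
    by (simp add: open_Compl)
  have "integral D ?f - integral D ?g = integral D (\<lambda>x. ?f x - ?g x)"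
    by (simp add: integral_diff int cont)
  also have "\<dots> = integral ({a..b} \<inter> D) (\<lambda>x. ?f x - ?g x)"
    using D(2) by (simp add: Int_absorb1)
  also have "\<dots> = integral {a..b} (\<lambda>x. if x \<in> D then ?f x - ?g x else 0)"
    by (simp add: Henstock_Kurzweil_Integration.integral_restrict_Int Int_commute)
  also have "\<dots> = integral {a..b} (\<lambda>x. ?f x - ?g x)"
    using out by (intro integral_cong) auto
  also have "\<dots> = integral {a..b} ?f - integral {a..b} ?g"
    by (intro integral_diff integrable_continuous_real cont)
  finally show ?thesis unfolding bienergy_def by simp
qed

lemma bienergy_has_derivative:
  fixes \<Psi> :: "'e::euclidean_space \<Rightarrow> 'a::euclidean_space"
  assumes S: "open S" and \<Psi>: "smooth_on \<Psi> S" and unit: "\<And>q. q \<in> S \<Longrightarrow> norm (\<Psi> q) = 1"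
    and line: "\<And>r x. \<bar>r\<bar> < \<delta> \<Longrightarrow> p + r *\<^sub>R w + x *\<^sub>R e \<in> S" and "\<delta> > 0"
    and D: "compact D" "D \<subseteq> {a..b}"
    and out: "\<And>r x. \<bar>r\<bar> < \<delta> \<Longrightarrow> x \<notin> D \<Longrightarrow> \<Psi> (p + r *\<^sub>R w + x *\<^sub>R e) = \<Psi> (p + x *\<^sub>R e)"
  shows "((\<lambda>r. bienergy (\<lambda>x. \<Psi> (p + r *\<^sub>R w + x *\<^sub>R e)) D) has_real_derivative
     integral {a..b} (\<lambda>x. first_variation_density e \<Psi> (dir_deriv w \<Psi>) (p + x *\<^sub>R e))) (at 0)"
proof -
  let ?d = "bienergy_density e \<Psi>"
  let ?I = "\<lambda>r. integral {a..b} (\<lambda>x. ?d (p + r *\<^sub>R w + x *\<^sub>R e))"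
  let ?B = "\<lambda>r. bienergy (\<lambda>x. \<Psi> (p + r *\<^sub>R w + x *\<^sub>R e)) D"
  note sm = smooth_on_densities(1)[OF S \<Psi>, of e]
  have line0: "p + x *\<^sub>R e \<in> S" for x using line[of 0 x] \<open>\<delta> > 0\<close> by simp
  have t: "(norm (tension (\<lambda>x. \<Psi> (p + r *\<^sub>R w + x *\<^sub>R e)) x))\<^sup>2 = ?d (p + r *\<^sub>R w + x *\<^sub>R e)"
    if "\<bar>r\<bar> < \<delta>" for r x
    by (rule norm_tension_line[OF S \<Psi> unit line[OF that]])
  have c: "continuous_on {a..b} (\<lambda>x. ?d (p + r *\<^sub>R w + x *\<^sub>R e))" if "\<bar>r\<bar> < \<delta>" for r
  proof (rule continuous_on_compose2[where f = "\<lambda>x. p + r *\<^sub>R w + x *\<^sub>R e" and g = ?d])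
    show "continuous_on S ?d" by (rule smooth_on_continuous_on[OF sm])
  qed (use line[OF that] in \<open>auto intro!: continuous_intros\<close>)
  have B: "?B r = ?B 0 + (1/2) * (?I r - ?I 0)" if r: "\<bar>r\<bar> < \<delta>" for r
  proof -
    have 0: "\<bar>0\<bar> < \<delta>" using \<open>\<delta> > 0\<close> by simp
    have "?B r - ?B 0 = (1/2) * (?I r - ?I 0)"
      using bienergy_diff_interval[OF D, of "\<lambda>x. \<Psi> (p + r *\<^sub>R w + x *\<^sub>R e)" "\<lambda>x. \<Psi> (p + 0 *\<^sub>R w + x *\<^sub>R e)"]
        c[OF r] c[OF 0] out[OF r] unfolding t[OF r] t[OF 0] by simp
    then show ?thesis by linarith
  qed
  have "(?I has_vector_derivative integral {a..b} (\<lambda>x. dir_deriv w ?d (p + 0 *\<^sub>R w + x *\<^sub>R e))) (at 0)"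
    by (rule leibniz_rule_smooth[OF sm line]) (use \<open>\<delta> > 0\<close> in auto)
  then have "(?I has_real_derivative integral {a..b} (\<lambda>x. dir_deriv w ?d (p + x *\<^sub>R e))) (at 0)"
    by (simp add: has_real_derivative_iff_has_vector_derivative)
  from DERIV_add[OF DERIV_const[of "?B 0"] DERIV_cmult[OF DERIV_diff[OF this DERIV_const[of "?I 0"]], of "1/2"]]
  have "((\<lambda>r. ?B 0 + (1/2) * (?I r - ?I 0)) has_real_derivative
      (1/2) * integral {a..b} (\<lambda>x. dir_deriv w ?d (p + x *\<^sub>R e))) (at 0)"
    by simp
  moreover have "(1/2) * integral {a..b} (\<lambda>x. dir_deriv w ?d (p + x *\<^sub>R e)) =
     integral {a..b} (\<lambda>x. first_variation_density e \<Psi> (dir_deriv w \<Psi>) (p + x *\<^sub>R e))"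
    unfolding dir_deriv_bienergy_density[OF S \<Psi> line0] by simp
  ultimately have F: "((\<lambda>r. ?B 0 + (1/2) * (?I r - ?I 0)) has_real_derivative
      integral {a..b} (\<lambda>x. first_variation_density e \<Psi> (dir_deriv w \<Psi>) (p + x *\<^sub>R e))) (at 0)"
    by simp
  show ?thesis
    by (rule has_field_derivative_transform_within_open[OF F, where S = "{-\<delta><..<\<delta>}"])
      (use \<open>\<delta> > 0\<close> B in auto)
qed

section \<open>Sphere curves solving the biharmonic equation\<close>

lemma compact_smooth_domain_compact: "compact_smooth_domain D \<Longrightarrow> compact D"
  unfolding compact_smooth_domain_def by (metis compact_Icc compact_Union)

lemma compact_subset_interval:
  assumes "compact (D :: real set)" obtains R where "R > 0" "D \<subseteq> {-R<..<R}"
proof -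
  obtain r where "\<And>x. x \<in> D \<Longrightarrow> norm x \<le> r"
    using compact_imp_bounded[OF assms] unfolding bounded_iff by blast
  then have "D \<subseteq> {-(\<bar>r\<bar> + 1)<..<\<bar>r\<bar> + 1}" by fastforce
  then show ?thesis using that[of "\<bar>r\<bar> + 1"] by simp
qed

lemma has_vector_derivative_zero_outside:
  assumes "closed D" "\<And>x. x \<notin> D \<Longrightarrow> Y x = 0" "(Y has_vector_derivative Y') (at x)" "x \<notin> D"
  shows "Y' = 0"
proof -
  have "((\<lambda>_. 0) has_vector_derivative Y') (at x)"
    by (rule has_vector_derivative_transform_within_open[OF assms(3), of "- D"])
      (use assms in \<open>auto simp: open_Compl\<close>)
  then show ?thesis using vector_derivative_unique_at has_vector_derivative_const by blast
qed

lemma has_mixed_derivative_0_unique: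
  assumes "has_mixed_derivative_0 F h" "has_mixed_derivative_0 F h'"
  shows "h = h'"
proof -
  obtain G where G: "\<forall>\<^sub>F t in nhds 0. ((\<lambda>s. F t s) has_real_derivative G t) (at 0)"
      and h: "(G has_real_derivative h) (at 0)"
    using assms(1) unfolding has_mixed_derivative_0_def by blast
  obtain G' where G': "\<forall>\<^sub>F t in nhds 0. ((\<lambda>s. F t s) has_real_derivative G' t) (at 0)"
      and h': "(G' has_real_derivative h') (at 0)"
    using assms(2) unfolding has_mixed_derivative_0_def by blast
  have "\<forall>\<^sub>F t in nhds 0. G t = G' t"
    using G G' by eventually_elim (rule DERIV_unique)
  then have "(G has_real_derivative h') (at 0)"
    using h' DERIV_cong_ev[of 0 0 G G' h' h'] by simp
  then show ?thesis using h DERIV_unique by blast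
qed

text \<open>
  \<open>\<phi>1\<close> to \<open>\<phi>4\<close> are the derivatives of \<open>\<phi>\<close>, and the equation is
  \<open>\<phi>'''' + 2 (\<bar>\<phi>'\<bar>\<^sup>2 \<phi>')' = \<mu> \<phi>\<close> with the derivative of the product expanded.
\<close>

locale sphere_curve_ode =
  fixes \<phi> \<phi>1 \<phi>2 \<phi>3 \<phi>4 :: "real \<Rightarrow> 'a::euclidean_space" and \<mu> :: "real \<Rightarrow> real"
  assumes sphere_map: "smooth_sphere_map \<phi>"
    and d1: "(\<phi> has_vector_derivative \<phi>1 x) (at x)"
    and d2: "(\<phi>1 has_vector_derivative \<phi>2 x) (at x)"
    and d3: "(\<phi>2 has_vector_derivative \<phi>3 x) (at x)"
    and d4: "(\<phi>3 has_vector_derivative \<phi>4 x) (at x)"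
    and ode: "\<phi>4 x + 2 *\<^sub>R ((2 * (\<phi>1 x \<bullet> \<phi>2 x)) *\<^sub>R \<phi>1 x + (\<phi>1 x \<bullet> \<phi>1 x) *\<^sub>R \<phi>2 x) = \<mu> x *\<^sub>R \<phi> x"
begin

lemma smooth: "smooth_on \<phi> UNIV" and unit: "norm (\<phi> x) = 1"
  using sphere_map by (auto simp: smooth_sphere_map_def)

text \<open>
  The equation tested against \<open>Y\<close>: the integrand is the derivative of the boundary expression
  \<open>\<phi>'' \<bullet> Y' - \<phi>''' \<bullet> Y - 2 \<bar>\<phi>'\<bar>\<^sup>2 (\<phi>' \<bullet> Y)\<close>, which vanishes at both ends because \<open>Y\<close> does so near them.
\<close>

lemma weak_ode:
  assumes Y: "\<And>x. (Y has_vector_derivative Y1 x) (at x)" "\<And>x. (Y1 has_vector_derivative Y2 x) (at x)"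
    and D: "closed D" "D \<subseteq> {-R<..<R}" "R > 0" "\<And>x. x \<notin> D \<Longrightarrow> Y x = 0"
  shows "((\<lambda>x. \<phi>2 x \<bullet> Y2 x - 2 * ((\<phi>1 x \<bullet> \<phi>1 x) * (\<phi>1 x \<bullet> Y1 x)) - \<mu> x * (\<phi> x \<bullet> Y x)) has_integral 0) {-R..R}"
proof -
  let ?B = "\<lambda>x. \<phi>2 x \<bullet> Y1 x - \<phi>3 x \<bullet> Y x - 2 * ((\<phi>1 x \<bullet> \<phi>1 x) * (\<phi>1 x \<bullet> Y x))"
  note d = d1 d2 d3 d4 Y
  note d' = d[unfolded has_vector_derivative_def]
  have eq: "\<mu> x * (\<phi> x \<bullet> y) = \<phi>4 x \<bullet> y + 4 * ((\<phi>1 x \<bullet> \<phi>2 x) * (\<phi>1 x \<bullet> y)) + 2 * ((\<phi>1 x \<bullet> \<phi>1 x) * (\<phi>2 x \<bullet> y))"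
    for x y
    using arg_cong[OF ode[of x], of "\<lambda>v. v \<bullet> y"] by (simp add: inner_add_left algebra_simps)
  have eq': "\<mu> x * (Y x \<bullet> \<phi> x) = Y x \<bullet> \<phi>4 x + 4 * ((\<phi>1 x \<bullet> \<phi>2 x) * (Y x \<bullet> \<phi>1 x)) + 2 * ((\<phi>1 x \<bullet> \<phi>1 x) * (Y x \<bullet> \<phi>2 x))"
    for x using eq[of x "Y x"] by (simp add: inner_commute)
  have B: "(?B has_vector_derivative
      \<phi>2 x \<bullet> Y2 x - 2 * ((\<phi>1 x \<bullet> \<phi>1 x) * (\<phi>1 x \<bullet> Y1 x)) - \<mu> x * (\<phi> x \<bullet> Y x)) (at x)" for x
    unfolding has_vector_derivative_def
    by (rule has_derivative_eq_rhs, (rule has_derivative_diff has_derivative_inner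
        has_derivative_mult_right has_derivative_mult d')+) (simp add: fun_eq_iff eq' algebra_simps inner_commute)
  have "((\<lambda>x. \<phi>2 x \<bullet> Y2 x - 2 * ((\<phi>1 x \<bullet> \<phi>1 x) * (\<phi>1 x \<bullet> Y1 x)) - \<mu> x * (\<phi> x \<bullet> Y x))
      has_integral ?B R - ?B (-R)) {-R..R}"
    by (rule fundamental_theorem_of_calculus[where f = ?B, OF _ has_vector_derivative_at_within[OF B]])
      (use D(3) in simp)
  moreover have "Y x = 0" "Y1 x = 0" if "x = R \<or> x = -R" for x
  proof -
    have "x \<notin> D" using D(2) that by auto
    then show "Y x = 0" "Y1 x = 0"
      using D(4) has_vector_derivative_zero_outside[OF D(1,4) Y(1)] by auto
  qed
  ultimately show ?thesis by simp
qed

lemma weak_ode_slice: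
  fixes \<Psi> Y :: "'e::euclidean_space \<Rightarrow> 'a"
  assumes S: "open S" "smooth_on \<Psi> S" "smooth_on Y S" and line: "\<And>x. p + x *\<^sub>R e \<in> S"
    and \<phi>: "\<And>x. \<Psi> (p + x *\<^sub>R e) = \<phi> x"
    and D: "closed D" "D \<subseteq> {-R<..<R}" "R > 0" "\<And>x. x \<notin> D \<Longrightarrow> Y (p + x *\<^sub>R e) = 0"
  shows "((\<lambda>x. first_variation_density e \<Psi> Y (p + x *\<^sub>R e) - \<mu> x * (\<phi> x \<bullet> Y (p + x *\<^sub>R e)))
      has_integral 0) {-R..R}"
proof -
  have 1: "dir_deriv e \<Psi> (p + x *\<^sub>R e) = \<phi>1 x" for x
    by (rule dir_deriv_line_eq[OF S(2) line \<phi> d1])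
  have 2: "dir_deriv e (dir_deriv e \<Psi>) (p + x *\<^sub>R e) = \<phi>2 x" for x
    by (rule dir_deriv_line_eq[OF smooth_on_dir_deriv[OF S(2)] line 1 d2])
  show "((\<lambda>x. first_variation_density e \<Psi> Y (p + x *\<^sub>R e) - \<mu> x * (\<phi> x \<bullet> Y (p + x *\<^sub>R e)))
      has_integral 0) {-R..R}"
    unfolding first_variation_density_def 1 2
    by (rule weak_ode[OF smooth_on_line[OF S(3) line] smooth_on_line[OF smooth_on_dir_deriv[OF S(3)] line] D])
qed

text \<open>
  The first variation is the weak equation tested against the variation field, hence equals
  \<open>\<integral> \<mu> (\<phi> \<bullet> Y)\<close>, and \<open>\<phi> \<bullet> Y = 0\<close> because the curves stay on the sphere.
\<close>

theorem biharmonic: "biharmonic \<phi>"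
  unfolding biharmonic_def
proof (intro conjI allI impI, rule sphere_map, elim conjE)
  fix D and \<Phi> :: "real \<Rightarrow> real \<Rightarrow> 'a"
  assume "compact_smooth_domain D" "variation1 \<phi> D \<Phi>"
  then obtain \<epsilon> where "\<epsilon> > 0" and sm: "smooth_on (\<lambda>(t, x). \<Phi> t x) ({-\<epsilon><..<\<epsilon>} \<times> UNIV)"
    and var: "\<forall>t\<in>{-\<epsilon><..<\<epsilon>}. (\<forall>x. \<Phi> t x \<in> sphere 0 1) \<and> (\<forall>x. x \<notin> D \<longrightarrow> \<Phi> t x = \<phi> x)"
    and \<Phi>0: "\<Phi> 0 = \<phi>"
    unfolding variation1_def by blast
  have sph: "\<And>t x. t \<in> {-\<epsilon><..<\<epsilon>} \<Longrightarrow> norm (\<Phi> t x) = 1"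
    and out: "\<And>t x. t \<in> {-\<epsilon><..<\<epsilon>} \<Longrightarrow> x \<notin> D \<Longrightarrow> \<Phi> t x = \<phi> x"
    using var by auto
  have D: "compact D" using \<open>compact_smooth_domain D\<close> by (rule compact_smooth_domain_compact)
  obtain R where R: "R > 0" "D \<subseteq> {-R<..<R}" using compact_subset_interval[OF D] .
  define \<Psi> where "\<Psi> = (\<lambda>(t, x). \<Phi> t x)"
  define S where "S = {-\<epsilon><..<\<epsilon>} \<times> (UNIV :: real set)"
  let ?w = "(1, 0) :: real \<times> real" and ?e = "(0, 1) :: real \<times> real"
  have S: "open S" unfolding S_def by (intro open_Times) auto
  have \<Psi>: "smooth_on \<Psi> S" using sm by (simp add: \<Psi>_def S_def)
  have un: "norm (\<Psi> q) = 1" if "q \<in> S" for q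
    using that sph by (auto simp: \<Psi>_def S_def)
  have line: "0 + x *\<^sub>R ?e \<in> S" for x using \<open>\<epsilon> > 0\<close> by (simp add: S_def)
  have sl: "\<Psi> (0 + x *\<^sub>R ?e) = \<phi> x" for x by (simp add: \<Psi>_def \<Phi>0)
  have Y0: "dir_deriv ?w \<Psi> (0 + x *\<^sub>R ?e) = 0" if "x \<notin> D" for x
  proof -
    have "dir_deriv ?w \<Psi> (x *\<^sub>R ?e) = 0"
    proof -
      have "((\<lambda>r. \<Psi> (x *\<^sub>R ?e + r *\<^sub>R ?w)) has_vector_derivative dir_deriv ?w \<Psi> (x *\<^sub>R ?e)) (at 0)"
        using smooth_on_line[OF \<Psi>, of "x *\<^sub>R ?e" 0 ?w] line[of x] by simp
      then have "((\<lambda>r. \<phi> x) has_vector_derivative dir_deriv ?w \<Psi> (x *\<^sub>R ?e)) (at 0)"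
        by (rule has_vector_derivative_transform_within_open[where S = "{-\<epsilon><..<\<epsilon>}"])
          (use \<open>\<epsilon> > 0\<close> out[OF _ that] in \<open>auto simp: \<Psi>_def\<close>)
      then show ?thesis using vector_derivative_unique_at has_vector_derivative_const by blast
    qed
    then show ?thesis by simp
  qed
  have orth: "\<phi> x \<bullet> dir_deriv ?w \<Psi> (0 + x *\<^sub>R ?e) = 0" for x
  proof -
    have "\<Psi> q \<bullet> \<Psi> q = 1" if "q \<in> S" for q using un[OF that] by (simp add: norm_eq_sqrt_inner)
    from dir_deriv_inner_const[OF S \<Psi> \<Psi> this line, of x ?w] show ?thesis
      unfolding sl by (simp add: inner_commute)
  qed
  have "((\<lambda>r. bienergy (\<lambda>x. \<Psi> (0 + r *\<^sub>R ?w + x *\<^sub>R ?e)) D) has_real_derivative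
     integral {-R..R} (\<lambda>x. first_variation_density ?e \<Psi> (dir_deriv ?w \<Psi>) (0 + x *\<^sub>R ?e))) (at 0)"
  proof (rule bienergy_has_derivative[OF S \<Psi> un _ \<open>\<epsilon> > 0\<close> D])
    show "D \<subseteq> {-R..R}" using R by auto
    show "0 + r *\<^sub>R ?w + x *\<^sub>R ?e \<in> S" if "\<bar>r\<bar> < \<epsilon>" for r x using that by (auto simp: S_def)
    show "\<Psi> (0 + r *\<^sub>R ?w + x *\<^sub>R ?e) = \<Psi> (0 + x *\<^sub>R ?e)" if "\<bar>r\<bar> < \<epsilon>" "x \<notin> D" for r x
      using that out[of r x] by (auto simp: \<Psi>_def \<Phi>0 abs_less_iff)
  qed
  moreover have "integral {-R..R} (\<lambda>x. first_variation_density ?e \<Psi> (dir_deriv ?w \<Psi>) (0 + x *\<^sub>R ?e)) = 0"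
    using weak_ode_slice[OF S \<Psi> smooth_on_dir_deriv[OF \<Psi>] line sl compact_imp_closed[OF D] R(2,1) Y0]
    unfolding orth by (simp add: integral_unique)
  ultimately show "((\<lambda>t. bienergy (\<Phi> t) D) has_real_derivative 0) (at 0)"
    by (simp add: \<Psi>_def)
qed

text \<open>
  The decisive point is that the mixed derivative \<open>Z\<close> of the variation, about which \<open>V\<close> and \<open>W\<close>
  say nothing, enters only through \<open>\<phi> \<bullet> Z\<close> once the weak equation is tested against it. The sphere
  constraint determines that product as \<open>- V \<bullet> W\<close>.
\<close>

lemma has_mixed_derivative_bienergy:
  assumes V: "\<And>x. (V has_vector_derivative V1 x) (at x)" "\<And>x. (V1 has_vector_derivative V2 x) (at x)"
    and W: "\<And>x. (W has_vector_derivative W1 x) (at x)" "\<And>x. (W1 has_vector_derivative W2 x) (at x)"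
    and D: "compact D" "D \<subseteq> {-R<..<R}" "R > 0"
    and var: "variation2 \<phi> D \<Phi>" "variation_fields \<Phi> V W"
  shows "has_mixed_derivative_0 (\<lambda>t s. bienergy (\<Phi> t s) D)
    (integral {-R..R} (\<lambda>x. V2 x \<bullet> W2 x - 2 * ((\<phi>1 x \<bullet> \<phi>1 x) * (V1 x \<bullet> W1 x))
       - 4 * ((\<phi>1 x \<bullet> V1 x) * (\<phi>1 x \<bullet> W1 x)) - \<mu> x * (V x \<bullet> W x)))"
    (is "has_mixed_derivative_0 _ (integral _ ?Q)")
proof -
  obtain \<epsilon> where "\<epsilon> > 0"
    and sm: "smooth_on (\<lambda>(t, s, x). \<Phi> t s x) ({-\<epsilon><..<\<epsilon>} \<times> {-\<epsilon><..<\<epsilon>} \<times> UNIV)"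
    and var': "\<forall>t\<in>{-\<epsilon><..<\<epsilon>}. \<forall>s\<in>{-\<epsilon><..<\<epsilon>}.
      (\<forall>x. \<Phi> t s x \<in> sphere 0 1) \<and> (\<forall>x. x \<notin> D \<longrightarrow> \<Phi> t s x = \<phi> x)"
    and \<Phi>0: "\<Phi> 0 0 = \<phi>"
    using var(1) unfolding variation2_def by blast
  have sph: "\<And>t s x. t \<in> {-\<epsilon><..<\<epsilon>} \<Longrightarrow> s \<in> {-\<epsilon><..<\<epsilon>} \<Longrightarrow> norm (\<Phi> t s x) = 1"
    and out: "\<And>t s x. t \<in> {-\<epsilon><..<\<epsilon>} \<Longrightarrow> s \<in> {-\<epsilon><..<\<epsilon>} \<Longrightarrow> x \<notin> D \<Longrightarrow> \<Phi> t s x = \<phi> x"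
    using var' by auto
  define \<Psi> where "\<Psi> = (\<lambda>(t, s, x). \<Phi> t s x)"
  define S where "S = {-\<epsilon><..<\<epsilon>} \<times> {-\<epsilon><..<\<epsilon>} \<times> (UNIV :: real set)"
  define et es ex :: "real \<times> real \<times> real" where "et = (1, 0, 0)" and "es = (0, 1, 0)" and "ex = (0, 0, 1)"
  note basis = et_def es_def ex_def
  have S: "open S" unfolding S_def by (intro open_Times) auto
  have \<Psi>: "smooth_on \<Psi> S" using sm by (simp add: \<Psi>_def S_def)
  have un: "norm (\<Psi> q) = 1" if "q \<in> S" for q
    using that sph by (auto simp: \<Psi>_def S_def)
  have un2: "\<Psi> q \<bullet> \<Psi> q = 1" if "q \<in> S" for q
    using un[OF that] by (simp add: norm_eq_sqrt_inner)
  note smd = smooth_on_dir_deriv[OF \<Psi>] smooth_on_dir_deriv[OF smooth_on_dir_deriv[OF \<Psi>]]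
  have line: "0 + x *\<^sub>R ex \<in> S" for x using \<open>\<epsilon> > 0\<close> by (simp add: S_def basis)
  have line_t: "0 + t *\<^sub>R et + x *\<^sub>R ex \<in> S" if "\<bar>t\<bar> < \<epsilon>" for t x
    using \<open>\<epsilon> > 0\<close> that by (auto simp: S_def basis)
  have line_ts: "(0 + t *\<^sub>R et) + s *\<^sub>R es + x *\<^sub>R ex \<in> S" if "\<bar>t\<bar> < \<epsilon>" "\<bar>s\<bar> < \<epsilon>" for t s x
    using that by (auto simp: S_def basis)
  have sl: "\<Psi> (0 + x *\<^sub>R ex) = \<phi> x" for x by (simp add: \<Psi>_def \<Phi>0 basis)
  have DV: "dir_deriv et \<Psi> (0 + x *\<^sub>R ex) = V x" for x
  proof -
    have 1: "((\<lambda>t. \<Psi> (x *\<^sub>R ex + t *\<^sub>R et)) has_vector_derivative dir_deriv et \<Psi> (x *\<^sub>R ex)) (at 0)"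
      using smooth_on_line[OF \<Psi>, of "x *\<^sub>R ex" 0 et] line[of x] by simp
    have 2: "((\<lambda>t. \<Psi> (x *\<^sub>R ex + t *\<^sub>R et)) has_vector_derivative V x) (at 0)"
      using var(2) by (simp add: variation_fields_def \<Psi>_def basis)
    show ?thesis using vector_derivative_unique_at[OF 1 2] by simp
  qed
  have DW: "dir_deriv es \<Psi> (0 + x *\<^sub>R ex) = W x" for x
  proof -
    have 1: "((\<lambda>t. \<Psi> (x *\<^sub>R ex + t *\<^sub>R es)) has_vector_derivative dir_deriv es \<Psi> (x *\<^sub>R ex)) (at 0)"
      using smooth_on_line[OF \<Psi>, of "x *\<^sub>R ex" 0 es] line[of x] by simp
    have 2: "((\<lambda>t. \<Psi> (x *\<^sub>R ex + t *\<^sub>R es)) has_vector_derivative W x) (at 0)"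
      using var(2) by (simp add: variation_fields_def \<Psi>_def basis)
    show ?thesis using vector_derivative_unique_at[OF 1 2] by simp
  qed
  \<comment> \<open>Outside \<open>D\<close> the variation is constant in both parameters, so \<open>Z\<close> is an admissible test field.\<close>
  let ?Z = "dir_deriv et (dir_deriv es \<Psi>)"
  have Y0: "dir_deriv es \<Psi> (x *\<^sub>R ex + t *\<^sub>R et) = 0" if "x \<notin> D" "\<bar>t\<bar> < \<epsilon>" for x t
  proof -
    let ?q = "x *\<^sub>R ex + t *\<^sub>R et"
    have "((\<lambda>r. \<Psi> (?q + r *\<^sub>R es)) has_vector_derivative dir_deriv es \<Psi> ?q) (at 0)"
      using smooth_on_line[OF \<Psi>, of ?q 0 es] line_t[OF that(2), of x] by (simp add: add.commute)
    then have "((\<lambda>r. \<phi> x) has_vector_derivative dir_deriv es \<Psi> ?q) (at 0)"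
      by (rule has_vector_derivative_transform_within_open[where S = "{-\<epsilon><..<\<epsilon>}"])
        (use \<open>\<epsilon> > 0\<close> that out[of t _ x] in \<open>auto simp: \<Psi>_def basis abs_less_iff\<close>)
    then show ?thesis using vector_derivative_unique_at has_vector_derivative_const by blast
  qed
  have Z0: "?Z (0 + x *\<^sub>R ex) = 0" if "x \<notin> D" for x
  proof -
    have "((\<lambda>t. dir_deriv es \<Psi> (x *\<^sub>R ex + t *\<^sub>R et)) has_vector_derivative ?Z (x *\<^sub>R ex)) (at 0)"
      using smooth_on_line[OF smd(1), of "x *\<^sub>R ex" 0 et] line[of x] by simp
    then have "((\<lambda>t. 0) has_vector_derivative ?Z (x *\<^sub>R ex)) (at 0)"
      by (rule has_vector_derivative_transform_within_open[where S = "{-\<epsilon><..<\<epsilon>}"])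
        (use \<open>\<epsilon> > 0\<close> Y0[OF that] in auto)
    from vector_derivative_unique_at[OF this has_vector_derivative_const] show ?thesis by simp
  qed
  have orth: "\<phi> x \<bullet> ?Z (0 + x *\<^sub>R ex) = - (V x \<bullet> W x)" for x
  proof -
    have "\<Psi> q \<bullet> dir_deriv es \<Psi> q = 0" if "q \<in> S" for q
      using dir_deriv_inner_const[OF S \<Psi> \<Psi> un2 that, of es] by (simp add: inner_commute)
    from dir_deriv_inner_const[OF S \<Psi> smd(1) this line, of x et]
    show ?thesis unfolding sl DV DW by simp
  qed
  let ?f = "first_variation_density ex \<Psi> (dir_deriv es \<Psi>)"
  define G where "G = (\<lambda>t. integral {-R..R} (\<lambda>x. ?f (0 + t *\<^sub>R et + x *\<^sub>R ex)))"
  have s_deriv: "((\<lambda>s. bienergy (\<Phi> t s) D) has_real_derivative G t) (at 0)" if t: "\<bar>t\<bar> < \<epsilon>" for t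
  proof -
    have "((\<lambda>s. bienergy (\<lambda>x. \<Psi> ((0 + t *\<^sub>R et) + s *\<^sub>R es + x *\<^sub>R ex)) D) has_real_derivative G t) (at 0)"
      unfolding G_def
    proof (rule bienergy_has_derivative[OF S \<Psi> un line_ts[OF t] \<open>\<epsilon> > 0\<close> D(1)])
      show "D \<subseteq> {-R..R}" using D(2) by auto
      show "\<Psi> (0 + t *\<^sub>R et + r *\<^sub>R es + x *\<^sub>R ex) = \<Psi> (0 + t *\<^sub>R et + x *\<^sub>R ex)"
        if "\<bar>r\<bar> < \<epsilon>" "x \<notin> D" for r x
        using that t \<open>\<epsilon> > 0\<close> out[of t r x] out[of t 0 x] by (auto simp: \<Psi>_def basis abs_less_iff)
    qed
    then show ?thesis by (simp add: \<Psi>_def basis)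
  qed
  have smf: "smooth_on ?f S" by (rule smooth_on_densities(2)[OF S \<Psi> smd(1)])
  let ?N = "\<lambda>x. dir_deriv et ?f (0 + x *\<^sub>R ex)"
  have "(G has_vector_derivative integral {-R..R} (\<lambda>x. dir_deriv et ?f (0 + 0 *\<^sub>R et + x *\<^sub>R ex))) (at 0)"
    unfolding G_def by (rule leibniz_rule_smooth[OF smf line_t]) (use \<open>\<epsilon> > 0\<close> in auto)
  then have G': "(G has_real_derivative integral {-R..R} ?N) (at 0)"
    by (simp add: has_real_derivative_iff_has_vector_derivative)
  have "continuous_on {-R..R} ?N"
  proof (rule continuous_on_compose2[where f = "\<lambda>x. 0 + x *\<^sub>R ex" and g = "dir_deriv et ?f"])
    show "continuous_on S (dir_deriv et ?f)" by (rule smooth_on_continuous_on[OF smooth_on_dir_deriv[OF smf]])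
  qed (use line in \<open>auto intro!: continuous_intros\<close>)
  then have N: "(?N has_integral integral {-R..R} ?N) {-R..R}"
    by (intro integrable_integral integrable_continuous_real)
  note ws = weak_ode_slice[OF S \<Psi> smd(2) line sl compact_imp_closed[OF D(1)] D(2,3) Z0]
  have \<phi>x: "dir_deriv ex \<Psi> (0 + x *\<^sub>R ex) = \<phi>1 x" for x
    by (rule dir_deriv_line_eq[OF \<Psi> line sl d1])
  have Vx: "dir_deriv ex (dir_deriv et \<Psi>) (0 + x *\<^sub>R ex) = V1 x"
      "dir_deriv ex (dir_deriv es \<Psi>) (0 + x *\<^sub>R ex) = W1 x" for x
    by (rule dir_deriv_line_eq[OF smd(1) line DV V(1)] dir_deriv_line_eq[OF smd(1) line DW W(1)])+
  have Vxx: "dir_deriv ex (dir_deriv ex (dir_deriv et \<Psi>)) (0 + x *\<^sub>R ex) = V2 x"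
      "dir_deriv ex (dir_deriv ex (dir_deriv es \<Psi>)) (0 + x *\<^sub>R ex) = W2 x" for x
    by (rule dir_deriv_line_eq[OF smd(2) line Vx(1) V(2)] dir_deriv_line_eq[OF smd(2) line Vx(2) W(2)])+
  have "?N x - (first_variation_density ex \<Psi> ?Z (0 + x *\<^sub>R ex) - \<mu> x * (\<phi> x \<bullet> ?Z (0 + x *\<^sub>R ex))) = ?Q x" for x
    unfolding dir_deriv_first_variation_density[OF S \<Psi> smd(1) line] second_variation_density_def
      Vx Vxx \<phi>x orth by simp
  with has_integral_diff[OF N ws] have "(?Q has_integral integral {-R..R} ?N) {-R..R}"
    by simp
  then have eq: "integral {-R..R} ?Q = integral {-R..R} ?N" by (rule integral_unique)
  have "\<forall>\<^sub>F t in nhds 0. t \<in> {-\<epsilon><..<\<epsilon>}"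
    using \<open>\<epsilon> > 0\<close> by (intro eventually_nhds_in_open) auto
  then have "\<forall>\<^sub>F t in nhds 0. ((\<lambda>s. bienergy (\<Phi> t s) D) has_real_derivative G t) (at 0)"
    by eventually_elim (simp add: s_deriv abs_less_iff)
  then show ?thesis
    unfolding has_mixed_derivative_0_def eq using G' by blast
qed

section \<open>Evaluation of the Hessian\<close>

text \<open>
  With \<open>u = (t V + s W) / 2\<close> tangent at \<open>\<phi>\<close>, the curve \<open>((1 - \<bar>u\<bar>\<^sup>2) \<phi> + 2 u) / (1 + \<bar>u\<bar>\<^sup>2)\<close> is the
  inverse stereographic projection of \<open>u\<close> from \<open>- \<phi>\<close>. Being rational with a denominator without
  zeros, it is smooth by the algebraic closure rules alone, in contrast to the exponential map.
\<close>

lemma variation2_exists: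
  assumes V: "smooth_section \<phi> V" "\<And>x. x \<notin> D \<Longrightarrow> V x = 0"
    and W: "smooth_section \<phi> W" "\<And>x. x \<notin> D \<Longrightarrow> W x = 0"
  shows "\<exists>\<Phi>. variation2 \<phi> D \<Phi> \<and> variation_fields \<Phi> V W"
proof -
  define u where "u = (\<lambda>t s x. (t / 2) *\<^sub>R V x + (s / 2) *\<^sub>R W x)"
  define q where "q = (\<lambda>t s x. u t s x \<bullet> u t s x)"
  define \<Phi> where "\<Phi> = (\<lambda>t s x. inverse (1 + q t s x) *\<^sub>R ((1 - q t s x) *\<^sub>R \<phi> x + 2 *\<^sub>R u t s x))"
  have q0: "0 < 1 + q t s x" for t s x
    unfolding q_def using inner_ge_zero[of "u t s x"] by linarith
  have \<phi>u: "\<phi> x \<bullet> u t s x = 0" for t s x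
    using V(1) W(1) by (simp add: u_def smooth_section_def inner_add_right inner_commute)
  have \<phi>\<phi>: "\<phi> x \<bullet> \<phi> x = 1" for x using unit[of x] by (simp add: norm_eq_sqrt_inner)
  have sphere: "\<Phi> t s x \<in> sphere 0 1" for t s x
  proof -
    have "((1 - q t s x) *\<^sub>R \<phi> x + 2 *\<^sub>R u t s x) \<bullet> ((1 - q t s x) *\<^sub>R \<phi> x + 2 *\<^sub>R u t s x) = (1 + q t s x)\<^sup>2"
    proof -
      have "u t s x \<bullet> \<phi> x = 0" "u t s x \<bullet> u t s x = q t s x"
        using \<phi>u by (simp_all add: inner_commute q_def)
      then show ?thesis
        by (simp add: inner_add_left inner_add_right \<phi>\<phi> \<phi>u power2_eq_square algebra_simps)
    qed
    then have "norm ((1 - q t s x) *\<^sub>R \<phi> x + 2 *\<^sub>R u t s x) = 1 + q t s x"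
      using q0[of t s x] by (simp add: norm_eq_sqrt_inner)
    then show ?thesis using q0[of t s x] by (simp add: \<Phi>_def)
  qed
  let ?B = "{-1<..<1::real} \<times> {-1<..<1::real} \<times> (UNIV :: real set)"
  have B: "open ?B" by (intro open_Times) auto
  have "smooth_on (\<lambda>z. \<Phi> (fst z) (fst (snd z)) (snd (snd z))) ?B"
  proof -
    have lin: "bounded_linear (\<lambda>z::real \<times> real \<times> real. fst (snd z))"
        "bounded_linear (\<lambda>z::real \<times> real \<times> real. snd (snd z))"
      using bounded_linear_compose[OF bounded_linear_fst bounded_linear_snd]
        bounded_linear_compose[OF bounded_linear_snd bounded_linear_snd] by auto
    have c: "smooth_on (\<lambda>z. g (snd (snd z))) ?B" if "smooth_on g UNIV" for g :: "real \<Rightarrow> 'a"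
      by (rule smooth_on_linear_compose[OF B lin(2) _ that]) simp
    note st = smooth_on_linear[OF B bounded_linear_fst] smooth_on_linear[OF B lin(1)]
    have VW: "smooth_on (\<lambda>z. V (snd (snd z))) ?B" "smooth_on (\<lambda>z. W (snd (snd z))) ?B"
      using V(1) W(1) c unfolding smooth_section_def by blast+
    have us: "smooth_on (\<lambda>z. u (fst z) (fst (snd z)) (snd (snd z))) ?B"
      unfolding u_def divide_inverse by (intro smooth_on_intros B st VW)
    have qs: "smooth_on (\<lambda>z. q (fst z) (fst (snd z)) (snd (snd z))) ?B"
      unfolding q_def by (intro smooth_on_inner B us)
    have "smooth_on (\<lambda>z. inverse (1 + q (fst z) (fst (snd z)) (snd (snd z)))) ?B"
    proof (rule smooth_on_inverse[OF B])
      show "1 + q (fst z) (fst (snd z)) (snd (snd z)) \<noteq> 0" for z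
        using q0[of "fst z" "fst (snd z)" "snd (snd z)"] by linarith
    qed (intro smooth_on_add smooth_on_const B qs)
    then show ?thesis
      unfolding \<Phi>_def
      by (intro smooth_on_scaleR smooth_on_add smooth_on_diff smooth_on_const B us qs c[OF smooth])
  qed
  moreover have "\<Phi> t s x = \<phi> x" if "x \<notin> D" for t s x
    using V(2)[OF that] W(2)[OF that] by (simp add: \<Phi>_def q_def u_def)
  moreover have "\<Phi> 0 0 = \<phi>" by (simp add: \<Phi>_def q_def u_def)
  ultimately have "variation2 \<phi> D \<Phi>"
    unfolding variation2_def case_prod_beta
    by (intro exI[of _ 1] conjI ballI allI impI) (use sphere in auto)
  have deriv: "((\<lambda>t. inverse (1 + ((t / 2) *\<^sub>R v) \<bullet> ((t / 2) *\<^sub>R v)) *\<^sub>R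
        ((1 - ((t / 2) *\<^sub>R v) \<bullet> ((t / 2) *\<^sub>R v)) *\<^sub>R \<phi> x + 2 *\<^sub>R (t / 2) *\<^sub>R v)) has_vector_derivative v) (at 0)"
    for v x
  proof -
    let ?k = "v \<bullet> v / 4"
    have "((\<lambda>t. inverse (1 + ?k * t\<^sup>2) *\<^sub>R ((1 - ?k * t\<^sup>2) *\<^sub>R \<phi> x + t *\<^sub>R v)) has_vector_derivative v) (at 0)"
      by (auto intro!: derivative_eq_intros)
    then show ?thesis by (simp add: power2_eq_square algebra_simps)
  qed
  have "variation_fields \<Phi> V W"
    unfolding variation_fields_def \<Phi>_def q_def u_def using deriv by simp
  with \<open>variation2 \<phi> D \<Phi>\<close> show ?thesis by blast
qed

lemma bienergy_hessian_eq:
  assumes V: "smooth_section \<phi> V" "\<And>x. x \<notin> D \<Longrightarrow> V x = 0"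
      "\<And>x. (V has_vector_derivative V1 x) (at x)" "\<And>x. (V1 has_vector_derivative V2 x) (at x)"
    and W: "smooth_section \<phi> W" "\<And>x. x \<notin> D \<Longrightarrow> W x = 0"
      "\<And>x. (W has_vector_derivative W1 x) (at x)" "\<And>x. (W1 has_vector_derivative W2 x) (at x)"
    and D: "compact D" "D \<subseteq> {-R<..<R}" "R > 0"
  shows "bienergy_hessian \<phi> D V W =
    integral {-R..R} (\<lambda>x. V2 x \<bullet> W2 x - 2 * ((\<phi>1 x \<bullet> \<phi>1 x) * (V1 x \<bullet> W1 x))
       - 4 * ((\<phi>1 x \<bullet> V1 x) * (\<phi>1 x \<bullet> W1 x)) - \<mu> x * (V x \<bullet> W x))"
proof -
  note mixed = has_mixed_derivative_bienergy[OF V(3,4) W(3,4) D]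
  obtain \<Phi> where \<Phi>: "variation2 \<phi> D \<Phi>" "variation_fields \<Phi> V W"
    using variation2_exists[OF V(1,2) W(1,2)] by blast
  show ?thesis
    unfolding bienergy_hessian_def
  proof (rule the_equality)
    show "h = integral {-R..R} (\<lambda>x. V2 x \<bullet> W2 x - 2 * ((\<phi>1 x \<bullet> \<phi>1 x) * (V1 x \<bullet> W1 x))
       - 4 * ((\<phi>1 x \<bullet> V1 x) * (\<phi>1 x \<bullet> W1 x)) - \<mu> x * (V x \<bullet> W x))"
      if "\<forall>\<Phi>. variation2 \<phi> D \<Phi> \<and> variation_fields \<Phi> V W \<longrightarrow>
        has_mixed_derivative_0 (\<lambda>t s. bienergy (\<Phi> t s) D) h" for h
      using that \<Phi> has_mixed_derivative_0_unique mixed[OF \<Phi>] by blast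
  qed (use mixed in blast)
qed

end

section \<open>Strict stability of the cubic reparametrisation of a great circle\<close>

lemma section_support_outside: "section_support V \<subseteq> D \<Longrightarrow> x \<notin> D \<Longrightarrow> V x = 0"
  unfolding section_support_def using closure_subset[of "{x. V x \<noteq> 0}"] by auto

lemma smooth_on_vector_derivatives:
  assumes "smooth_on V UNIV"
  obtains V1 V2 where "smooth_on V1 UNIV" "smooth_on V2 UNIV"
    "\<And>x. (V has_vector_derivative V1 x) (at x)" "\<And>x::real. (V1 has_vector_derivative V2 x) (at x)"
proof -
  have *: "(U has_vector_derivative dir_deriv 1 U x) (at x)" if "smooth_on U UNIV" for U :: "real \<Rightarrow> 'a" and x
    using smooth_on_line[OF that, of 0 x 1] by simp
  note V1 = smooth_on_dir_deriv[OF assms, of 1]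
  show thesis by (rule that[OF V1 smooth_on_dir_deriv[OF V1] *[OF assms] *[OF V1]])
qed

lemma zero_of_second_derivative_zero:
  fixes f :: "real \<Rightarrow> real"
  assumes f: "\<And>x. (f has_real_derivative f1 x) (at x)" "\<And>x. (f1 has_real_derivative 0) (at x)"
    and x0: "f x0 = 0" "f1 x0 = 0"
  shows "f x = 0"
proof -
  have f1: "f1 y = 0" for y using DERIV_isconst_all[of f1 y x0] f(2) x0(2) by metis
  have "(f has_real_derivative 0) (at y)" for y using f(1)[of y] unfolding f1 .
  then show ?thesis using DERIV_isconst_all[of f x x0] x0(1) by metis
qed

locale cubic_angle =
  fixes a b c d :: real and A :: "real \<Rightarrow> real" and \<phi> :: "real \<Rightarrow> real ^ 3"
  assumes A: "A x = a * x ^ 3 + b * x\<^sup>2 + c * x + d"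
    and \<phi>: "\<phi> x = vector [cos (A x), sin (A x), 0]"
begin

text \<open>
  \<open>\<alpha>\<close> and \<open>\<alpha>1\<close> are the first two derivatives of \<open>A\<close>, the third being the constant \<open>6 a\<close>. The fields
  \<open>e1\<close> (the unit tangent of the great circle) and \<open>e2\<close> (its unit normal in the sphere) are parallel
  along \<open>\<phi>\<close>.
\<close>

definition "\<alpha> x = 3 * a * x\<^sup>2 + 2 * b * x + c"
definition "\<alpha>1 x = 6 * a * x + 2 * b"
definition "e1 x = (vector [- sin (A x), cos (A x), 0] :: real ^ 3)"
definition "e2 = (vector [0, 0, 1] :: real ^ 3)"

lemma angle_derivs:
  "(A has_real_derivative \<alpha> x) (at x)" "(\<alpha> has_real_derivative \<alpha>1 x) (at x)"
  "(\<alpha>1 has_real_derivative 6 * a) (at x)"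
  unfolding A[abs_def] \<alpha>_def[abs_def] \<alpha>1_def[abs_def]
  by (auto intro!: derivative_eq_intros simp: power2_eq_square)

lemma frame_coordinates:
  "\<phi> x = cos (A x) *\<^sub>R axis 1 1 + sin (A x) *\<^sub>R axis 2 1"
  "e1 x = (- sin (A x)) *\<^sub>R axis 1 1 + cos (A x) *\<^sub>R axis 2 1"
  by (simp_all add: \<phi> e1_def vec_eq_iff forall_3 vector_3 axis_def)

lemma frame_derivs:
  "(\<phi> has_vector_derivative \<alpha> x *\<^sub>R e1 x) (at x)"
  "(e1 has_vector_derivative - \<alpha> x *\<^sub>R \<phi> x) (at x)"
  unfolding frame_coordinates[abs_def]
  by (auto intro!: derivative_eq_intros angle_derivs simp: algebra_simps)

lemma frame_orthonormal:
  "\<phi> x \<bullet> \<phi> x = 1" "e1 x \<bullet> e1 x = 1" "e2 \<bullet> e2 = 1"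
  "\<phi> x \<bullet> e1 x = 0" "e1 x \<bullet> \<phi> x = 0"
  by (simp_all add: \<phi> e1_def e2_def inner_vec_def sum_3 vector_3 power2_eq_square[symmetric])

lemma frame_parseval: "u \<bullet> w = (u \<bullet> \<phi> x) * (w \<bullet> \<phi> x) + (u \<bullet> e1 x) * (w \<bullet> e1 x) + (u \<bullet> e2) * (w \<bullet> e2)"
proof -
  have rot: "(u1 * p + u2 * q) * (w1 * p + w2 * q) + (u2 * p - u1 * q) * (w2 * p - w1 * q) = u1 * w1 + u2 * w2"
    if "p\<^sup>2 + q\<^sup>2 = 1" for p q u1 u2 w1 w2 :: real
  proof -
    have "(u1 * p + u2 * q) * (w1 * p + w2 * q) + (u2 * p - u1 * q) * (w2 * p - w1 * q)
        = (p\<^sup>2 + q\<^sup>2) * (u1 * w1 + u2 * w2)"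
      by (simp add: power2_eq_square algebra_simps)
    then show ?thesis using that by simp
  qed
  show ?thesis
    using rot[of "cos (A x)" "sin (A x)" "u $ 1" "u $ 2" "w $ 1" "w $ 2"]
    by (simp add: \<phi> e1_def e2_def inner_vec_def sum_3 vector_3)
qed

text \<open>
  Since \<open>\<phi>' = \<alpha> e1\<close> and \<open>e1' = - \<alpha> \<phi>\<close>, differentiability of one field improves that of the other,
  so the induction on the order treats both together.
\<close>

lemma smooth_on_frame: "smooth_on \<phi> UNIV"
proof -
  have \<alpha>: "Ck_on k \<alpha> UNIV" for k
  proof -
    have "smooth_on (\<lambda>x. 3 * a * (x * x) + 2 * b * x + c) (UNIV :: real set)"
      by (intro smooth_on_add smooth_on_mult smooth_on_const smooth_on_linear bounded_linear_ident open_UNIV)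
    then show ?thesis by (simp add: \<alpha>_def[abs_def] power2_eq_square smooth_on_def)
  qed
  have "Ck_on k \<phi> UNIV \<and> Ck_on k e1 UNIV" for k
  proof (induction k)
    case 0
    have "continuous_on UNIV \<phi>" "continuous_on UNIV e1"
      by (auto intro!: continuous_at_imp_continuous_on has_vector_derivative_continuous[OF frame_derivs(1)]
          has_vector_derivative_continuous[OF frame_derivs(2)])
    then show ?case by simp
  next
    case (Suc k)
    have c: "Ck_on k (\<lambda>x. (v * r) *\<^sub>R \<alpha> x *\<^sub>R g x) UNIV" if "Ck_on k g UNIV" for v r :: real and g :: "real \<Rightarrow> real^3"
      by (intro Ck_on_bilinear[OF bounded_bilinear_scaleR] Ck_on_const \<alpha> that open_UNIV)
    have "Ck_on (Suc k) \<phi> UNIV"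
      by (rule Ck_on_SucI[where f' = "\<lambda>x v. (v * 1) *\<^sub>R \<alpha> x *\<^sub>R e1 x"])
        (use frame_derivs(1) c[of e1, where r = 1] Suc in \<open>auto simp: has_vector_derivative_def\<close>)
    moreover have "Ck_on (Suc k) e1 UNIV"
      by (rule Ck_on_SucI[where f' = "\<lambda>x v. (v * (-1)) *\<^sub>R \<alpha> x *\<^sub>R \<phi> x"])
        (use frame_derivs(2) c[of \<phi>, where r = "-1"] Suc in \<open>auto simp: has_vector_derivative_def\<close>)
    ultimately show ?case by simp
  qed
  then show ?thesis by (simp add: smooth_on_def)
qed

text \<open>
  In \<open>\<phi>'''' + 2 (\<bar>\<phi>'\<bar>\<^sup>2 \<phi>')'\<close> the \<open>e1\<close> component is \<open>A''''\<close>, which is zero for a cubic. The coefficient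
  of \<open>\<phi>\<close> gives the multiplier \<open>\<mu> = - (4 \<alpha> \<alpha>'' + \<alpha>^4 + 3 \<alpha>'\<^sup>2)\<close>.
\<close>

sublocale sphere_curve_ode \<phi>
  "\<lambda>x. \<alpha> x *\<^sub>R e1 x"
  "\<lambda>x. \<alpha>1 x *\<^sub>R e1 x - (\<alpha> x)\<^sup>2 *\<^sub>R \<phi> x"
  "\<lambda>x. (6 * a - \<alpha> x ^ 3) *\<^sub>R e1 x - (3 * \<alpha> x * \<alpha>1 x) *\<^sub>R \<phi> x"
  "\<lambda>x. (- 6 * (\<alpha> x)\<^sup>2 * \<alpha>1 x) *\<^sub>R e1 x + (\<alpha> x ^ 4 - 24 * a * \<alpha> x - 3 * (\<alpha>1 x)\<^sup>2) *\<^sub>R \<phi> x"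
  "\<lambda>x. - (24 * a * \<alpha> x + \<alpha> x ^ 4 + 3 * (\<alpha>1 x)\<^sup>2)"
proof
  show "smooth_sphere_map \<phi>"
    using smooth_on_frame frame_orthonormal(1) by (simp add: smooth_sphere_map_def norm_eq_sqrt_inner)
  fix x
  show "(\<phi> has_vector_derivative \<alpha> x *\<^sub>R e1 x) (at x)" by (rule frame_derivs)
  show "((\<lambda>x. \<alpha> x *\<^sub>R e1 x) has_vector_derivative \<alpha>1 x *\<^sub>R e1 x - (\<alpha> x)\<^sup>2 *\<^sub>R \<phi> x) (at x)"
    by (auto intro!: derivative_eq_intros angle_derivs frame_derivs simp: power2_eq_square algebra_simps)
  show "((\<lambda>x. \<alpha>1 x *\<^sub>R e1 x - (\<alpha> x)\<^sup>2 *\<^sub>R \<phi> x) has_vector_derivative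
      (6 * a - \<alpha> x ^ 3) *\<^sub>R e1 x - (3 * \<alpha> x * \<alpha>1 x) *\<^sub>R \<phi> x) (at x)"
    by (auto intro!: derivative_eq_intros angle_derivs frame_derivs
        simp: vec_eq_iff power2_eq_square power3_eq_cube algebra_simps)
  show "((\<lambda>x. (6 * a - \<alpha> x ^ 3) *\<^sub>R e1 x - (3 * \<alpha> x * \<alpha>1 x) *\<^sub>R \<phi> x) has_vector_derivative
      (- 6 * (\<alpha> x)\<^sup>2 * \<alpha>1 x) *\<^sub>R e1 x + (\<alpha> x ^ 4 - 24 * a * \<alpha> x - 3 * (\<alpha>1 x)\<^sup>2) *\<^sub>R \<phi> x) (at x)"
    by (auto intro!: derivative_eq_intros angle_derivs frame_derivs
        simp: vec_eq_iff power2_eq_square power3_eq_cube power4_eq_xxxx algebra_simps)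
  show "(- 6 * (\<alpha> x)\<^sup>2 * \<alpha>1 x) *\<^sub>R e1 x + (\<alpha> x ^ 4 - 24 * a * \<alpha> x - 3 * (\<alpha>1 x)\<^sup>2) *\<^sub>R \<phi> x +
    2 *\<^sub>R ((2 * ((\<alpha> x *\<^sub>R e1 x) \<bullet> (\<alpha>1 x *\<^sub>R e1 x - (\<alpha> x)\<^sup>2 *\<^sub>R \<phi> x))) *\<^sub>R \<alpha> x *\<^sub>R e1 x
      + ((\<alpha> x *\<^sub>R e1 x) \<bullet> (\<alpha> x *\<^sub>R e1 x)) *\<^sub>R (\<alpha>1 x *\<^sub>R e1 x - (\<alpha> x)\<^sup>2 *\<^sub>R \<phi> x))
    = (- (24 * a * \<alpha> x + \<alpha> x ^ 4 + 3 * (\<alpha>1 x)\<^sup>2)) *\<^sub>R \<phi> x"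
    by (simp add: frame_orthonormal inner_diff_right vec_eq_iff power2_eq_square power4_eq_xxxx
        algebra_simps)
qed

lemma tension_cubic: "tension \<phi> x = \<alpha>1 x *\<^sub>R e1 x"
proof -
  have "(\<lambda>y. vector_derivative \<phi> (at y)) = (\<lambda>y. \<alpha> y *\<^sub>R e1 y)"
    by (intro ext vector_derivative_at d1)
  then show ?thesis
    unfolding tension_def cov_deriv_def tangent_proj_def
    by (simp add: vector_derivative_at[OF d2] inner_diff_left frame_orthonormal)
qed

text \<open>
  \<open>\<alpha>'\<^sup>2 + 2 \<alpha> \<alpha>''\<close> is a quadratic polynomial in \<open>x\<close> whose discriminant has the sign of
  \<open>b\<^sup>2 - 3 a c\<close>. It is written as \<open>8 (3 a x + b)\<^sup>2 - 4 (b\<^sup>2 - 3 a c)\<close>; for \<open>a = 0\<close> it is the positive constant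
  \<open>4 b\<^sup>2\<close>. In that case the second claim is vacuous.
\<close>

lemma hessian_potential_nonneg:
  assumes "a\<^sup>2 + b\<^sup>2 > 0" "a = 0 \<or> (a \<noteq> 0 \<and> b\<^sup>2 - 3 * a * c \<le> 0)"
  shows "(\<alpha>1 x)\<^sup>2 + 12 * a * \<alpha> x \<ge> 0"
    and "(\<alpha>1 x)\<^sup>2 + 12 * a * \<alpha> x = 0 \<Longrightarrow> x = - b / (3 * a)"
proof -
  define s where "s = (3 * a * x + b)\<^sup>2"
  define t where "t = b\<^sup>2 - 3 * a * c"
  have eq: "(\<alpha>1 x)\<^sup>2 + 12 * a * \<alpha> x = 8 * s - 4 * t"
    by (simp add: \<alpha>_def \<alpha>1_def s_def t_def power2_eq_square algebra_simps)
  have s: "s \<ge> 0" by (simp add: s_def)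
  show "(\<alpha>1 x)\<^sup>2 + 12 * a * \<alpha> x \<ge> 0"
  proof (cases "a = 0")
    case False
    then have "t \<le> 0" using assms(2) by (simp add: t_def)
    then show ?thesis using s unfolding eq by linarith
  qed (simp add: \<alpha>1_def)
  show "x = - b / (3 * a)" if "(\<alpha>1 x)\<^sup>2 + 12 * a * \<alpha> x = 0"
  proof (cases "a = 0")
    case True
    then show ?thesis using that assms(1) unfolding \<alpha>1_def by simp
  next
    case False
    then have "t \<le> 0" using assms(2) by (simp add: t_def)
    then have "s = 0" using that s unfolding eq by linarith
    then show ?thesis using False by (simp add: s_def field_simps)
  qed
qed

text \<open>
  Differentiating \<open>V \<bullet> \<phi> = 0\<close> expresses the normal components of \<open>V'\<close> and \<open>V''\<close> by \<open>f\<close> and \<open>f'\<close>. The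
  Hessian integrand then differs from the sum of squares by the derivative of
  \<open>K = 4 \<alpha> \<alpha>' f\<^sup>2 + 2 \<alpha> \<alpha>' g\<^sup>2 - 2 \<alpha>\<^sup>2 (f f' + g g')\<close>. All terms in \<open>f\<close> except \<open>f''\<^sup>2\<close> disappear in this way,
  in accordance with the bienergy of a curve in the great circle being \<open>\<integral> A''\<^sup>2 / 2\<close>.
\<close>

lemma hessian_sum_of_squares:
  assumes V: "smooth_section \<phi> V" "\<And>x. x \<notin> D \<Longrightarrow> V x = 0"
    and D: "compact D" "D \<subseteq> {-R<..<R}" "R > 0"
  obtains f f1 f2 g g1 g2 where
    "\<And>x. V x = f x *\<^sub>R e1 x + g x *\<^sub>R e2"
    "\<And>x. (f has_real_derivative f1 x) (at x)" "\<And>x. (f1 has_real_derivative f2 x) (at x)"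
    "\<And>x. (g has_real_derivative g1 x) (at x)" "\<And>x. (g1 has_real_derivative g2 x) (at x)"
    "continuous_on UNIV f2" "continuous_on UNIV g2"
    "bienergy_hessian \<phi> D V V = integral {-R..R}
       (\<lambda>x. (f2 x)\<^sup>2 + (g2 x + (\<alpha> x)\<^sup>2 * g x)\<^sup>2 + ((\<alpha>1 x)\<^sup>2 + 12 * a * \<alpha> x) * (g x)\<^sup>2)"
proof -
  have smV: "smooth_on V UNIV" and V\<phi>: "V x \<bullet> \<phi> x = 0" for x
    using V(1) by (auto simp: smooth_section_def)
  obtain V1 V2 where smV': "smooth_on V1 UNIV" "smooth_on V2 UNIV"
    and dV: "\<And>x. (V has_vector_derivative V1 x) (at x)" "\<And>x. (V1 has_vector_derivative V2 x) (at x)"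
    using smooth_on_vector_derivatives[OF smV] by blast
  have inner: "((\<lambda>x. u x \<bullet> w x) has_real_derivative u x \<bullet> w' + u' \<bullet> w x) (at x)"
    if "(u has_vector_derivative u') (at x)" "(w has_vector_derivative w') (at x)"
    for u w :: "real \<Rightarrow> real^3" and u' w' x
    unfolding has_real_derivative_iff_has_vector_derivative
    by (rule bounded_bilinear.has_vector_derivative[OF bounded_bilinear_inner that])
  define f where "f = (\<lambda>x. V x \<bullet> e1 x)"
  define f1 where "f1 = (\<lambda>x. V1 x \<bullet> e1 x)"
  define f2 where "f2 = (\<lambda>x. V2 x \<bullet> e1 x + (\<alpha> x)\<^sup>2 * f x)"
  define g where "g = (\<lambda>x. V x \<bullet> e2)"
  define g1 where "g1 = (\<lambda>x. V1 x \<bullet> e2)"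
  define g2 where "g2 = (\<lambda>x. V2 x \<bullet> e2)"
  have f: "(f has_real_derivative f1 x) (at x)" for x
    using inner[OF dV(1) frame_derivs(2), of x] by (simp add: f_def f1_def V\<phi>)
  have V1\<phi>: "V1 x \<bullet> \<phi> x = - (\<alpha> x * f x)" for x
  proof -
    have "((\<lambda>x. V x \<bullet> \<phi> x) has_real_derivative \<alpha> x * f x + V1 x \<bullet> \<phi> x) (at x)"
      using inner[OF dV(1) frame_derivs(1), of x] by (simp add: f_def)
    then have "((\<lambda>x. 0) has_real_derivative \<alpha> x * f x + V1 x \<bullet> \<phi> x) (at x)" by (simp add: V\<phi>)
    from DERIV_unique[OF this DERIV_const] show ?thesis by simp
  qed
  have f1: "(f1 has_real_derivative f2 x) (at x)" for x
    using inner[OF dV(2) frame_derivs(2), of x]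
    by (simp add: f1_def f2_def V1\<phi> power2_eq_square algebra_simps)
  have V2\<phi>: "V2 x \<bullet> \<phi> x = - (2 * \<alpha> x * f1 x + \<alpha>1 x * f x)" for x
  proof -
    have "((\<lambda>x. V1 x \<bullet> \<phi> x) has_real_derivative \<alpha> x * f1 x + V2 x \<bullet> \<phi> x) (at x)"
      using inner[OF dV(2) frame_derivs(1), of x] by (simp add: f1_def)
    then have "((\<lambda>x. - (\<alpha> x * f x)) has_real_derivative \<alpha> x * f1 x + V2 x \<bullet> \<phi> x) (at x)"
      by (simp add: V1\<phi>)
    moreover have "((\<lambda>x. - (\<alpha> x * f x)) has_real_derivative - (\<alpha> x * f1 x + \<alpha>1 x * f x)) (at x)"
      by (auto intro!: derivative_eq_intros angle_derivs f simp: algebra_simps)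
    ultimately show ?thesis using DERIV_unique by fastforce
  qed
  have g: "(g has_real_derivative g1 x) (at x)" "(g1 has_real_derivative g2 x) (at x)" for x
    using inner[OF dV(1) has_vector_derivative_const[of e2], of x]
      inner[OF dV(2) has_vector_derivative_const[of e2], of x]
    by (simp_all add: g_def g1_def g2_def)
  have decomp: "V x = f x *\<^sub>R e1 x + g x *\<^sub>R e2" for x
  proof -
    have e2: "e1 x \<bullet> e2 = 0" "e2 \<bullet> e1 x = 0" "e2 \<bullet> \<phi> x = 0"
      by (simp_all add: e1_def e2_def \<phi> inner_vec_def sum_3 vector_3)
    let ?d = "V x - (f x *\<^sub>R e1 x + g x *\<^sub>R e2)"
    have "?d \<bullet> ?d = 0"
      unfolding frame_parseval[of ?d ?d x]
      by (simp add: f_def g_def inner_diff_left inner_add_left frame_orthonormal V\<phi> e2)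
    then show ?thesis by simp
  qed
  define K where "K = (\<lambda>x. 4 * \<alpha> x * \<alpha>1 x * (f x)\<^sup>2 + 2 * \<alpha> x * \<alpha>1 x * (g x)\<^sup>2
      - 2 * (\<alpha> x)\<^sup>2 * (f x * f1 x) - 2 * (\<alpha> x)\<^sup>2 * (g x * g1 x))"
  define K' where "K' = (\<lambda>x. 4 * (\<alpha>1 x)\<^sup>2 * (f x)\<^sup>2 + 24 * a * \<alpha> x * (f x)\<^sup>2 + 4 * \<alpha> x * \<alpha>1 x * f x * f1 x
      + 2 * (\<alpha>1 x)\<^sup>2 * (g x)\<^sup>2 + 12 * a * \<alpha> x * (g x)\<^sup>2
      - 2 * (\<alpha> x)\<^sup>2 * ((f1 x)\<^sup>2 + f x * f2 x) - 2 * (\<alpha> x)\<^sup>2 * ((g1 x)\<^sup>2 + g x * g2 x))"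
  let ?F = "\<lambda>x. (f2 x)\<^sup>2 + (g2 x + (\<alpha> x)\<^sup>2 * g x)\<^sup>2 + ((\<alpha>1 x)\<^sup>2 + 12 * a * \<alpha> x) * (g x)\<^sup>2"
  have K: "(K has_real_derivative K' x) (at x)" for x
    unfolding K_def K'_def
    by (auto intro!: derivative_eq_intros angle_derivs f f1 g simp: power2_eq_square algebra_simps)
  have zero: "f x = 0" "g x = 0" if "x \<notin> D" for x
    using V(2)[OF that] by (simp_all add: f_def g_def)
  have K0: "K R = 0" "K (-R) = 0"
  proof -
    have "R \<notin> D" "- R \<notin> D" using D(2) by auto
    then show "K R = 0" "K (-R) = 0" by (simp_all add: K_def zero)
  qed
  have "(K' has_integral K R - K (-R)) {-R..R}"
    using D(3) by (intro fundamental_theorem_of_calculus[OF _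
        has_vector_derivative_at_within[OF K[unfolded has_real_derivative_iff_has_vector_derivative]]]) auto
  then have K'0: "(K' has_integral 0) {-R..R}" by (simp add: K0)
  have c: "continuous_on UNIV f" "continuous_on UNIV g" "continuous_on UNIV \<alpha>" "continuous_on UNIV \<alpha>1"
    using f g(1) angle_derivs(2,3) by (auto intro!: DERIV_continuous_on)
  have "continuous_on UNIV e1"
    using has_vector_derivative_continuous[OF frame_derivs(2)]
    by (intro continuous_at_imp_continuous_on ballI)
  note ce = continuous_on_inner[OF smooth_on_continuous_on[OF smV'(2)] this]
    continuous_on_inner[OF smooth_on_continuous_on[OF smV'(2)] continuous_on_const]
  have cont: "continuous_on UNIV f2" "continuous_on UNIV g2"
    unfolding f2_def g2_def by (intro continuous_on_add continuous_on_mult continuous_on_power ce c)+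
  have "continuous_on UNIV ?F" by (intro continuous_intros c cont)
  then have F: "(?F has_integral integral {-R..R} ?F) {-R..R}"
    by (intro integrable_integral integrable_continuous_real) (rule continuous_on_subset, auto)
  have "V2 x \<bullet> V2 x - 2 * (((\<alpha> x *\<^sub>R e1 x) \<bullet> (\<alpha> x *\<^sub>R e1 x)) * (V1 x \<bullet> V1 x))
       - 4 * (((\<alpha> x *\<^sub>R e1 x) \<bullet> V1 x) * ((\<alpha> x *\<^sub>R e1 x) \<bullet> V1 x))
       - (- (24 * a * \<alpha> x + \<alpha> x ^ 4 + 3 * (\<alpha>1 x)\<^sup>2)) * (V x \<bullet> V x) = ?F x + K' x" for x
  proof -
    have 2: "V2 x \<bullet> e1 x = f2 x - (\<alpha> x)\<^sup>2 * f x" by (simp add: f2_def)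
    have V2: "V2 x \<bullet> V2 x = (2 * \<alpha> x * f1 x + \<alpha>1 x * f x)\<^sup>2 + (f2 x - (\<alpha> x)\<^sup>2 * f x)\<^sup>2 + (g2 x)\<^sup>2"
      unfolding frame_parseval[of "V2 x" "V2 x" x] V2\<phi> 2 by (simp add: g2_def power2_eq_square algebra_simps)
    have V1: "V1 x \<bullet> V1 x = (\<alpha> x * f x)\<^sup>2 + (f1 x)\<^sup>2 + (g1 x)\<^sup>2"
      unfolding frame_parseval[of "V1 x" "V1 x" x] V1\<phi> by (simp add: f1_def g1_def power2_eq_square)
    have V0: "V x \<bullet> V x = (f x)\<^sup>2 + (g x)\<^sup>2"
      unfolding frame_parseval[of "V x" "V x" x] V\<phi> by (simp add: f_def g_def power2_eq_square)
    have e: "(\<alpha> x *\<^sub>R e1 x) \<bullet> V1 x = \<alpha> x * f1 x" "(\<alpha> x *\<^sub>R e1 x) \<bullet> (\<alpha> x *\<^sub>R e1 x) = (\<alpha> x)\<^sup>2"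
      by (simp_all add: f1_def inner_commute frame_orthonormal power2_eq_square)
    show ?thesis
      unfolding V2 V1 V0 e K'_def by algebra
  qed
  then have "bienergy_hessian \<phi> D V V = integral {-R..R} (\<lambda>x. ?F x + K' x)"
    using bienergy_hessian_eq[OF V dV V dV D] by simp
  also have "\<dots> = integral {-R..R} ?F"
    using has_integral_add[OF F K'0] by (simp add: integral_unique)
  finally show thesis using that[OF decomp f f1 g cont] by simp
qed

text \<open>
  If the integral of the sum of squares is zero, each square vanishes. Then \<open>f\<close> is affine with compact
  support, and \<open>g\<close> vanishes wherever the potential is positive, which leaves one point to continuity.
\<close>

theorem strictly_stable_cubic:
  assumes ab: "a\<^sup>2 + b\<^sup>2 > 0" "a = 0 \<or> (a \<noteq> 0 \<and> b\<^sup>2 - 3 * a * c \<le> 0)"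
  shows "strictly_stable \<phi>"
  unfolding strictly_stable_def
proof (intro conjI allI impI, rule biharmonic, elim conjE exE)
  fix V D x0
  assume V: "smooth_section \<phi> V" and supp: "section_support V \<subseteq> D"
    and dom: "compact_smooth_domain D" and V0: "V x0 \<noteq> 0"
  have D: "compact D" using dom by (rule compact_smooth_domain_compact)
  obtain R where R: "R > 0" "D \<subseteq> {-R<..<R}" using compact_subset_interval[OF D] .
  have VD: "V x = 0" if "x \<notin> D" for x using section_support_outside[OF supp that] .
  note closedD = compact_imp_closed[OF D]
  let ?P = "\<lambda>x. (\<alpha>1 x)\<^sup>2 + 12 * a * \<alpha> x"
  obtain f f1 f2 g g1 g2 where decomp: "\<And>x. V x = f x *\<^sub>R e1 x + g x *\<^sub>R e2"
    and f: "\<And>x. (f has_real_derivative f1 x) (at x)" "\<And>x. (f1 has_real_derivative f2 x) (at x)"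
    and g: "\<And>x. (g has_real_derivative g1 x) (at x)" "\<And>x. (g1 has_real_derivative g2 x) (at x)"
    and cont: "continuous_on UNIV f2" "continuous_on UNIV g2"
    and H: "bienergy_hessian \<phi> D V V = integral {-R..R}
       (\<lambda>x. (f2 x)\<^sup>2 + (g2 x + (\<alpha> x)\<^sup>2 * g x)\<^sup>2 + ?P x * (g x)\<^sup>2)"
    by (rule hessian_sum_of_squares[OF V VD D R(2,1)], assumption, rule that)
  let ?F = "\<lambda>x. (f2 x)\<^sup>2 + (g2 x + (\<alpha> x)\<^sup>2 * g x)\<^sup>2 + ?P x * (g x)\<^sup>2"
  note P = hessian_potential_nonneg[OF ab]
  have F_nonneg: "?F x \<ge> 0" for x using P(1)[of x] by simp
  have cg: "continuous_on UNIV g" "continuous_on UNIV \<alpha>" "continuous_on UNIV \<alpha>1"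
    using g(1) angle_derivs(2,3) by (auto intro!: DERIV_continuous_on)
  have "continuous_on UNIV ?F" by (intro continuous_intros cg cont)
  then have contF: "continuous_on {-R..R} ?F" by (rule continuous_on_subset) simp
  have "integral {-R..R} ?F \<noteq> 0"
  proof
    assume "integral {-R..R} ?F = 0"
    then have F0: "?F x = 0" if "x \<in> {-R..R}" for x
      using integral_eq_0_iff[OF contF _ F_nonneg] R(1) that by auto
    have zero: "f x = 0" "g x = 0" if "x \<notin> D" for x
    proof -
      have orth: "e1 x \<bullet> e2 = 0" by (simp add: e1_def e2_def inner_vec_def sum_3 vector_3)
      have "f x *\<^sub>R e1 x + g x *\<^sub>R e2 = 0" using decomp[of x] VD[OF that] by simp
      then have "e1 x \<bullet> (f x *\<^sub>R e1 x + g x *\<^sub>R e2) = 0" "(f x *\<^sub>R e1 x + g x *\<^sub>R e2) \<bullet> e2 = 0"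
        by simp_all
      then show "f x = 0" "g x = 0"
        by (simp_all add: inner_add_left inner_add_right frame_orthonormal orth)
    qed
    have f1_zero: "f1 x = 0" if "x \<notin> D" for x
      by (rule has_vector_derivative_zero_outside[OF closedD zero(1)
            f(1)[unfolded has_real_derivative_iff_has_vector_derivative] that])
    have f2_zero: "f2 x = 0" for x
    proof (cases "x \<in> D")
      case True
      then have "x \<in> {-R..R}" using R(2) by auto
      moreover have "(f2 x)\<^sup>2 \<le> ?F x" using P(1)[of x] by simp
      ultimately show ?thesis using F0[of x] by simp
    next
      case False
      show ?thesis
        by (rule has_vector_derivative_zero_outside[OF closedD f1_zero
            f(2)[unfolded has_real_derivative_iff_has_vector_derivative] False])
    qed
    have RD: "R \<notin> D" using R(2) by auto
    have f_zero: "f x = 0" for x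
    proof (rule zero_of_second_derivative_zero[OF f(1) _ zero(1)[OF RD] f1_zero[OF RD]])
      show "(f1 has_real_derivative 0) (at x)" for x using f(2)[of x] unfolding f2_zero .
    qed
    have g_zero': "g x = 0" if "x \<noteq> - b / (3 * a)" for x
    proof (cases "x \<in> D")
      case True
      then have "x \<in> {-R..R}" using R(2) by auto
      moreover have "?P x * (g x)\<^sup>2 \<le> ?F x" by simp
      ultimately have "?P x * (g x)\<^sup>2 \<le> 0" using F0[of x] by simp
      moreover have "?P x > 0" using P[of x] that by force
      ultimately show ?thesis by (simp add: mult_le_0_iff)
    qed (rule zero(2))
    have g_zero: "g x = 0" for x
    proof (cases "x = - b / (3 * a)")
      case True
      have "(g \<longlongrightarrow> g x) (at x)" using DERIV_isCont[OF g(1)] by (simp add: isCont_def)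
      moreover have "(g \<longlongrightarrow> 0) (at x)"
        by (rule tendsto_eventually) (use g_zero' True in \<open>auto simp: eventually_at_filter\<close>)
      ultimately show ?thesis using tendsto_unique trivial_limit_at by blast
    qed (rule g_zero')
    show False using decomp[of x0] V0 f_zero g_zero by simp
  qed
  moreover have "integral {-R..R} ?F \<ge> 0"
    by (rule integral_nonneg[OF integrable_continuous_real[OF contF]]) (rule F_nonneg)
  ultimately show "bienergy_hessian \<phi> D V V > 0" unfolding H by simp
qed

lemma proper_biharmonic_cubic:
  assumes "a\<^sup>2 + b\<^sup>2 > 0"
  shows "proper_biharmonic \<phi>"
proof -
  have "\<exists>x. \<alpha>1 x \<noteq> 0"
  proof (cases "b = 0")
    case True
    then have "\<alpha>1 1 \<noteq> 0" using assms unfolding \<alpha>1_def by simp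
    then show ?thesis ..
  next
    case False
    then have "\<alpha>1 0 \<noteq> 0" unfolding \<alpha>1_def by simp
    then show ?thesis ..
  qed
  then obtain x where "\<alpha>1 x \<noteq> 0" ..
  moreover have "e1 x \<noteq> 0" using frame_orthonormal(2)[of x] by auto
  ultimately have "tension \<phi> x \<noteq> 0" by (simp add: tension_cubic)
  then show ?thesis using biharmonic by (auto simp: proper_biharmonic_def)
qed

end

theorem theorem1p16:
  fixes a b c d :: real and A :: "real \<Rightarrow> real" and \<phi> :: "real \<Rightarrow> real ^ 3"
  assumes "a\<^sup>2 + b\<^sup>2 > 0"
    and "\<And>\<gamma>. A \<gamma> = a * \<gamma> ^ 3 + b * \<gamma>\<^sup>2 + c * \<gamma> + d"
    and "\<And>\<gamma>. \<phi> \<gamma> = vector [cos (A \<gamma>), sin (A \<gamma>), 0]"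
    and "a = 0 \<or> (a \<noteq> 0 \<and> b\<^sup>2 - 3 * a * c \<le> 0)"
  shows "proper_biharmonic \<phi> \<and> strictly_stable \<phi>"
proof -
  interpret cubic_angle a b c d A \<phi>
    by standard (fact assms)+
  show ?thesis
    using proper_biharmonic_cubic[OF assms(1)] strictly_stable_cubic[OF assms(1,4)] by blast
qed

end
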